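(* Let $X$ be a limit space and let $\mathcal{O}$ be a convergence system for $X$ which is closed under finite intersections ($U\cap V\in\mathcal{O}$ for all $U,V\in\mathcal{O}$). Regard $\mathcal{O}$ as a small category whose morphisms are the inclusions, and consider the functor $\Pi|_{\mathcal{O}}$ from $\mathcal{O}$ to the category of groupoids sending $U\in\mathcal{O}$ to the fundamental groupoid $\Pi(U)$ and an inclusion $U\subseteq V$ to the induced functor $\Pi(U)\to\Pi(V)$. Then the colimit of $\Pi|_{\mathcal{O}}$ in the category of groupoids is the fundamental groupoid $\Pi(X)$ (with the cocone of functors $\Pi(U)\to\Pi(X)$ induced by the inclusions $U\subseteq X$).
   Context: Nets and filters. A net in a set $X$ is a function $\varphi:\mathbb{D}\to X$ from a (nonempty) directed preordered set; $\varphi^{\uparrow}$ is the proper filter of all subsets of $X$ containing a tail $\{\varphi_d: d\ge d'\}$ for some $d'\in\mathbb{D}$. Every proper filter on $X$ is of the form $\varphi^\uparrow$. A net $\psi$ is a subnet of $\varphi$ if $\varphi^{\uparrow}\subseteq\psi^{\uparrow}$. If $\varphi,\psi$ have the same domain, a mixing of $\varphi$ and $\psi$ is a net $\rho$ with that domain and $\rho_d\in\{\varphi_d,\psi_d\}$ for all $d$. Limit spaces. A preconvergence $L$ on $X$ assigns to each net $\varphi$ in $X$ a set $L(\varphi)\subseteq X$ such that $L(\varphi)=L(\psi)$ whenever $\varphi^{\uparrow}=\psi^{\uparrow}$ (equivalently, it is a function from the proper filters on $X$ to subsets of $X$); write $\varphi\to_L x$ if $x\in L(\varphi)$. $\langle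 X,L\rangle$ is a limit space if $L$ is centered (constant nets converge to their value), isotone ($\varphi\to_L x$ and $\psi$ a subnet of $\varphi$ imply $\psi\to_L x$) and stable ($\varphi,\psi\to_L x$ and $\rho$ a mixing of them imply $\rho\to_L x$). A function $f$ is continuous if $f\circ\varphi\to f(x)$ whenever $\varphi\to x$. A subset $U\subseteq X$ carries the subspace convergence: a net in $U$ converges to $x\in U$ iff it does so in $X$. A topological space is a limit space with its usual net convergence; $[0,1]$ carries its usual convergence. Convergence system. A family $\mathcal{C}$ of subsets of $X$ is a convergence system for $X$ if for every $x\in X$ and every net $\varphi\to x$ there is $C\in\mathcal{C}$ with $C\in\varphi^{\uparrow}$. Function spaces. $\mathcal{C}(Y,X)$ denotes the set of continuous functions $Y\to X$ with continuous convergence: $f_a\to f$ (for a net indexed by $\mathbb{A}$) iff for every net $\langle y_b\rangle_{b\in\mathbb{B}}$ with $y_b\to y$ in $Y$, the net $\langle f_a(y_b)\rangle_{\langle a,b\rangle\in\mathbb{A}\times\mathbb{B}}$ (product preorder) converges to $f(y)$. Fundamental groupoid. A path in $X$ from $x$ to $y$ is a continuous $\gamma:[0,1]\to X$ with $\gamma(0)=x$, $\gamma(1)=y$. Two paths $\gamma,\gamma'$ from $x$ to $y$ are rel-homotopic if there is a continuous $H:[0,1]\to\mathcal{C}([0,1],X)$ with $H(0)=\gamma$, $H(1)=\gamma'$ and $H(t)$ a path from $x$ to $y$ for every $t$. $\Pi(X)$ is the groupoid whose objects are the points of $X$ and whose arrows $x\to y$ are the rel-homotopy classes $[\gamma]$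 of paths from $x$ to $y$; for $[\gamma]:x\to y$ and $[\rho]:y\to z$, the composite $[\rho]\circ[\gamma]$ is $[\gamma*\rho]$, where $(\gamma*\rho)(t)=\gamma(2t)$ for $t\le\frac12$ and $\rho(2t-1)$ for $t\ge\frac12$. A continuous $f:X\to Y$ induces the functor $\Pi(f):\Pi(X)\to\Pi(Y)$, $x\mapsto f(x)$, $[\gamma]\mapsto[f\circ\gamma]$. *)

theory Defs
  imports "HOL-Analysis.Analysis"
begin

section \<open>Nets and filters\<close>

text \<open>
  A net in \<open>X\<close> is given by a domain \<open>D\<close>, a preorder \<open>le\<close> on it, and a function \<open>\<phi>\<close> from \<open>D\<close> to \<open>X\<close>.
  A proper filter on a subset \<open>X\<close> of a type is represented by a proper filter of that type that
  contains \<open>X\<close>. The library orders filters by reverse inclusion of the families of sets: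
  \<open>F \<le> G\<close> means that every set of \<open>G\<close> belongs to \<open>F\<close>.
\<close>

definition directed_preorder :: "'i set \<Rightarrow> ('i \<Rightarrow> 'i \<Rightarrow> bool) \<Rightarrow> bool" where
  "directed_preorder D le \<longleftrightarrow> D \<noteq> {} \<and> reflp_on D le \<and> transp_on D le \<and>
     (\<forall>a\<in>D. \<forall>b\<in>D. \<exists>c\<in>D. le a c \<and> le b c)"

definition tails :: "'i set \<Rightarrow> ('i \<Rightarrow> 'i \<Rightarrow> bool) \<Rightarrow> ('i \<Rightarrow> 'a) \<Rightarrow> 'a filter" where
  "tails D le \<phi> = (INF d\<in>D. principal (\<phi> ` {e\<in>D. le d e}))"

definition proper_on :: "'a set \<Rightarrow> 'a filter \<Rightarrow> bool" where
  "proper_on X F \<longleftrightarrow> F \<noteq> bot \<and> F \<le> principal X"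

lemma eventually_tails:
  assumes "directed_preorder D le"
  shows "eventually P (tails D le \<phi>) \<longleftrightarrow> (\<exists>d\<in>D. \<forall>e\<in>D. le d e \<longrightarrow> P (\<phi> e))"
proof -
  have "eventually P (tails D le \<phi>) \<longleftrightarrow>
      (\<exists>d\<in>D. eventually P (principal (\<phi> ` {e\<in>D. le d e})))"
    unfolding tails_def
  proof (rule eventually_INF_base)
    show "D \<noteq> {}" using assms by (simp add: directed_preorder_def)
    fix a b assume ab: "a \<in> D" "b \<in> D"
    then obtain c where c: "c \<in> D" "le a c" "le b c"
      using assms unfolding directed_preorder_def by blast
    have "transp_on D le" using assms by (simp add: directed_preorder_def)
    then have "{e\<in>D. le c e} \<subseteq> {e\<in>D. le a e} \<inter> {e\<in>D. le b e}"
      using ab c unfolding transp_on_def by blast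
    then show "\<exists>x\<in>D. principal (\<phi> ` {e\<in>D. le x e}) \<le>
        inf (principal (\<phi> ` {e\<in>D. le a e})) (principal (\<phi> ` {e\<in>D. le b e}))"
      using c(1) by (intro bexI[of _ c]) auto
  qed
  then show ?thesis by (auto simp: eventually_principal)
qed

lemma proper_on_tails:
  assumes "directed_preorder D le" "\<phi> \<in> D \<rightarrow> X"
  shows "proper_on X (tails D le \<phi>)"
proof -
  have "\<not> eventually (\<lambda>_. False) (tails D le \<phi>)"
    using assms(1) by (auto simp: eventually_tails directed_preorder_def reflp_on_def)
  moreover have "eventually (\<lambda>x. x \<in> X) (tails D le \<phi>)"
    using assms by (auto simp: eventually_tails directed_preorder_def)
  ultimately show ?thesis
    by (auto simp: proper_on_def trivial_limit_def le_principal)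
qed

lemma tails_const:
  assumes "directed_preorder D le"
  shows "tails D le (\<lambda>_. x) = principal {x}"
  using assms
  by (auto simp: filter_eq_iff eventually_tails eventually_principal directed_preorder_def
      reflp_on_def)

lemma filtermap_tails:
  assumes "directed_preorder D le"
  shows "filtermap f (tails D le \<phi>) = tails D le (f \<circ> \<phi>)"
  using assms by (simp add: filter_eq_iff eventually_filtermap eventually_tails)

lemma directed_preorder_Times:
  assumes "directed_preorder A leA" "directed_preorder B leB"
  shows "directed_preorder (A \<times> B) (\<lambda>(a, b) (a', b'). leA a a' \<and> leB b b')"
  unfolding directed_preorder_def
proof (intro conjI ballI)
  show "A \<times> B \<noteq> {}" using assms by (auto simp: directed_preorder_def)
  show "reflp_on (A \<times> B) (\<lambda>(a, b) (a', b'). leA a a' \<and> leB b b')"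
    using assms by (auto simp: directed_preorder_def reflp_on_def)
  have "transp_on A leA" "transp_on B leB" using assms by (simp_all add: directed_preorder_def)
  then show "transp_on (A \<times> B) (\<lambda>(a, b) (a', b'). leA a a' \<and> leB b b')"
    by (intro transp_onI) (auto dest: transp_onD)
next
  fix p q assume "p \<in> A \<times> B" "q \<in> A \<times> B"
  then obtain a b a' b' where pq: "p = (a, b)" "q = (a', b')" "a \<in> A" "a' \<in> A" "b \<in> B" "b' \<in> B"
    by auto
  obtain c where "c \<in> A" "leA a c" "leA a' c"
    using assms(1) pq unfolding directed_preorder_def by meson
  moreover obtain d where "d \<in> B" "leB b d" "leB b' d"
    using assms(2) pq unfolding directed_preorder_def by meson
  ultimately show "\<exists>r\<in>A \<times> B. (case p of (a, b) \<Rightarrow> \<lambda>(a', b'). leA a a' \<and> leB b b') r \<and>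
      (case q of (a, b) \<Rightarrow> \<lambda>(a', b'). leA a a' \<and> leB b b') r"
    using pq by (intro bexI[of _ "(c, d)"]) auto
qed

lemma tails_Times:
  assumes A: "directed_preorder A leA" and B: "directed_preorder B leB"
  shows "tails (A \<times> B) (\<lambda>(a, b) (a', b'). leA a a' \<and> leB b b') (\<lambda>(a, b). (\<phi> a, \<psi> b)) =
    tails A leA \<phi> \<times>\<^sub>F tails B leB \<psi>"
proof -
  have "eventually P (tails A leA \<phi> \<times>\<^sub>F tails B leB \<psi>) \<longleftrightarrow>
      (\<exists>a\<in>A. \<exists>b\<in>B. \<forall>a'\<in>A. \<forall>b'\<in>B. leA a a' \<longrightarrow> leB b b' \<longrightarrow> P (\<phi> a', \<psi> b'))" for P
  proof
    assume "eventually P (tails A leA \<phi> \<times>\<^sub>F tails B leB \<psi>)"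
    then show "\<exists>a\<in>A. \<exists>b\<in>B. \<forall>a'\<in>A. \<forall>b'\<in>B. leA a a' \<longrightarrow> leB b b' \<longrightarrow> P (\<phi> a', \<psi> b')"
      unfolding eventually_prod_filter eventually_tails[OF A] eventually_tails[OF B] by meson
  next
    assume "\<exists>a\<in>A. \<exists>b\<in>B. \<forall>a'\<in>A. \<forall>b'\<in>B. leA a a' \<longrightarrow> leB b b' \<longrightarrow> P (\<phi> a', \<psi> b')"
    then obtain a b where ab: "a \<in> A" "b \<in> B"
      "\<forall>a'\<in>A. \<forall>b'\<in>B. leA a a' \<longrightarrow> leB b b' \<longrightarrow> P (\<phi> a', \<psi> b')" by blast
    show "eventually P (tails A leA \<phi> \<times>\<^sub>F tails B leB \<psi>)"
      unfolding eventually_prod_filter eventually_tails[OF A] eventually_tails[OF B]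
      by (rule exI[of _ "\<lambda>x. x \<in> \<phi> ` {a'\<in>A. leA a a'}"],
          rule exI[of _ "\<lambda>y. y \<in> \<psi> ` {b'\<in>B. leB b b'}"]) (use ab in auto)
  qed
  then show ?thesis
    by (simp add: filter_eq_iff eventually_tails[OF directed_preorder_Times[OF A B]])
       blast
qed

lemma proper_on_imp_tails:
  fixes F :: "'a filter"
  assumes "proper_on X F"
  obtains D :: "('a \<times> 'a set) set" and le \<phi>
  where "directed_preorder D le" "\<phi> \<in> D \<rightarrow> X" "tails D le \<phi> = F"
proof -
  define D :: "('a \<times> 'a set) set"
    where "D = {(x, A). x \<in> A \<and> A \<subseteq> X \<and> eventually (\<lambda>y. y \<in> A) F}"
  define le :: "'a \<times> 'a set \<Rightarrow> 'a \<times> 'a set \<Rightarrow> bool" where "le = (\<lambda>p q. snd q \<subseteq> snd p)"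
  have X: "eventually (\<lambda>y. y \<in> X) F" and nb: "F \<noteq> bot"
    using assms by (auto simp: proper_on_def le_principal)
  have ne: "\<exists>x. x \<in> A" if "eventually (\<lambda>y. y \<in> A) F" for A
    using eventually_happens[OF that] nb by blast
  have dir: "directed_preorder D le"
    unfolding directed_preorder_def
  proof (intro conjI ballI)
    show "D \<noteq> {}" using ne[OF X] X by (auto simp: D_def)
    show "reflp_on D le" "transp_on D le" by (auto simp: le_def reflp_on_def transp_on_def)
    fix p q assume pq: "p \<in> D" "q \<in> D"
    then have "eventually (\<lambda>y. y \<in> snd p \<inter> snd q) F"
      by (auto simp: D_def elim: eventually_elim2)
    moreover from ne[OF this] obtain x where "x \<in> snd p \<inter> snd q" by blast
    ultimately show "\<exists>r\<in>D. le p r \<and> le q r"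
      using pq by (intro bexI[of _ "(x, snd p \<inter> snd q)"]) (auto simp: D_def le_def)
  qed
  have "eventually P (tails D le fst) \<longleftrightarrow> eventually P F" for P
  proof
    assume "eventually P (tails D le fst)"
    then obtain x A where xA: "(x, A) \<in> D" "\<forall>e\<in>D. le (x, A) e \<longrightarrow> P (fst e)"
      unfolding eventually_tails[OF dir] by auto
    then have "\<forall>y\<in>A. P y" by (auto simp: D_def le_def)
    moreover have "eventually (\<lambda>y. y \<in> A) F" using xA(1) by (simp add: D_def)
    ultimately show "eventually P F" by (auto elim: eventually_mono)
  next
    assume "eventually P F"
    then have ev: "eventually (\<lambda>y. y \<in> {y\<in>X. P y}) F" using X by (auto elim: eventually_elim2)
    from ne[OF ev] obtain x where "x \<in> {y\<in>X. P y}" by blast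
    then show "eventually P (tails D le fst)"
      unfolding eventually_tails[OF dir] using ev
      by (intro bexI[of _ "(x, {y\<in>X. P y})"]) (auto simp: D_def le_def)
  qed
  then have "tails D le fst = F" by (simp add: filter_eq_iff)
  moreover have "fst \<in> D \<rightarrow> X" by (auto simp: D_def)
  ultimately show thesis using that dir by blast
qed


section \<open>Limit spaces\<close>

text \<open>
  A preconvergence is a function from filters to sets of limits, of which only the values at proper
  filters on \<open>X\<close> matter; a net \<open>\<phi>\<close> converges to \<open>x\<close> iff \<open>x \<in> L (tails D le \<phi>)\<close>.
\<close>

definition preconvergence :: "'a set \<Rightarrow> ('a filter \<Rightarrow> 'a set) \<Rightarrow> bool" where
  "preconvergence X L \<longleftrightarrow> (\<forall>F. proper_on X F \<longrightarrow> L F \<subseteq> X)"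

definition centered :: "'a set \<Rightarrow> ('a filter \<Rightarrow> 'a set) \<Rightarrow> bool" where
  "centered X L \<longleftrightarrow> (\<forall>x\<in>X. x \<in> L (principal {x}))"

definition isotone :: "'a set \<Rightarrow> ('a filter \<Rightarrow> 'a set) \<Rightarrow> bool" where
  "isotone X L \<longleftrightarrow> (\<forall>F G. proper_on X F \<and> proper_on X G \<and> G \<le> F \<longrightarrow> L F \<subseteq> L G)"

text \<open>
  A mixing is a notion for nets, so a type of indices has to be fixed. The one below is large
  enough: see \<open>stable_nets\<close> and \<open>stable_iff\<close>.
\<close>

type_synonym 'a net_index = "('a \<times> 'a set) \<times> ('a \<times> 'a set) \<times> bool"

definition stable :: "'a set \<Rightarrow> ('a filter \<Rightarrow> 'a set) \<Rightarrow> bool" where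
  "stable X L \<longleftrightarrow> (\<forall>(D :: 'a net_index set) le \<phi> \<psi> \<rho> x.
     directed_preorder D le \<and> \<phi> \<in> D \<rightarrow> X \<and> \<psi> \<in> D \<rightarrow> X \<and> (\<forall>d\<in>D. \<rho> d \<in> {\<phi> d, \<psi> d}) \<and>
     x \<in> L (tails D le \<phi>) \<and> x \<in> L (tails D le \<psi>) \<longrightarrow> x \<in> L (tails D le \<rho>))"

definition limit_space :: "'a set \<Rightarrow> ('a filter \<Rightarrow> 'a set) \<Rightarrow> bool" where
  "limit_space X L \<longleftrightarrow> preconvergence X L \<and> centered X L \<and> isotone X L \<and> stable X L"

lemma mixing_tails_le:
  assumes dir: "directed_preorder D le" and mix: "\<forall>d\<in>D. \<rho> d \<in> {\<phi> d, \<psi> d}"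
  shows "tails D le \<rho> \<le> sup (tails D le \<phi>) (tails D le \<psi>)"
proof (rule filter_leI)
  fix P assume "eventually P (sup (tails D le \<phi>) (tails D le \<psi>))"
  then obtain a b where ab: "a \<in> D" "b \<in> D"
    "\<forall>e\<in>D. le a e \<longrightarrow> P (\<phi> e)" "\<forall>e\<in>D. le b e \<longrightarrow> P (\<psi> e)"
    by (auto simp: eventually_sup eventually_tails[OF dir])
  obtain c where c: "c \<in> D" "le a c" "le b c"
    using dir ab(1,2) unfolding directed_preorder_def by blast
  have "transp_on D le" using dir by (simp add: directed_preorder_def)
  then have "\<forall>e\<in>D. le c e \<longrightarrow> le a e \<and> le b e"
    using ab(1,2) c unfolding transp_on_def by blast
  then have "\<forall>e\<in>D. le c e \<longrightarrow> P (\<rho> e)" using ab(3,4) mix by (metis insertE singletonD)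
  then show "eventually P (tails D le \<rho>)" using c(1) by (auto simp: eventually_tails[OF dir])
qed

lemma stable_iff:
  assumes "isotone X L"
  shows "stable X L \<longleftrightarrow>
    (\<forall>F G. proper_on X F \<and> proper_on X G \<longrightarrow> L F \<inter> L G \<subseteq> L (sup F G))"
proof
  assume st: "stable X L"
  show "\<forall>F G. proper_on X F \<and> proper_on X G \<longrightarrow> L F \<inter> L G \<subseteq> L (sup F G)"
  proof (intro allI impI subsetI)
    fix F G x assume FG: "proper_on X F \<and> proper_on X G" and x: "x \<in> L F \<inter> L G"
    obtain A :: "('a \<times> 'a set) set" and leA \<alpha>
      where A: "directed_preorder A leA" "\<alpha> \<in> A \<rightarrow> X" "tails A leA \<alpha> = F"
      using FG proper_on_imp_tails by metis
    obtain B :: "('a \<times> 'a set) set" and leB \<beta>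
      where B: "directed_preorder B leB" "\<beta> \<in> B \<rightarrow> X" "tails B leB \<beta> = G"
      using FG proper_on_imp_tails by metis
    define D where "D = A \<times> B \<times> (UNIV :: bool set)"
    define le where "le = (\<lambda>(a, b, _ :: bool) (a', b', _ :: bool). leA a a' \<and> leB b b')"
    define \<phi> where "\<phi> = (\<lambda>(a :: 'a \<times> 'a set, b :: 'a \<times> 'a set, i :: bool). \<alpha> a)"
    define \<psi> where "\<psi> = (\<lambda>(a :: 'a \<times> 'a set, b :: 'a \<times> 'a set, i :: bool). \<beta> b)"
    define \<rho> where "\<rho> = (\<lambda>d. if snd (snd d) then \<phi> d else \<psi> d)"
    have reflA: "\<And>a. a \<in> A \<Longrightarrow> leA a a" and reflB: "\<And>b. b \<in> B \<Longrightarrow> leB b b"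
      and ne: "A \<noteq> {}" "B \<noteq> {}"
      using A(1) B(1) by (auto simp: directed_preorder_def reflp_on_def)
    have "directed_preorder (UNIV :: bool set) (\<lambda>_ _. True)"
      by (simp add: directed_preorder_def reflp_on_def transp_on_def)
    from directed_preorder_Times[OF A(1) directed_preorder_Times[OF B(1) this]]
    have dir: "directed_preorder D le"
      by (simp add: D_def le_def case_prod_unfold)
    have ev\<phi>: "eventually P (tails D le \<phi>) \<longleftrightarrow> eventually P F" for P
      unfolding A(3)[symmetric] eventually_tails[OF dir] eventually_tails[OF A(1)]
      using ne reflB by (simp add: D_def le_def \<phi>_def) blast
    have ev\<psi>: "eventually P (tails D le \<psi>) \<longleftrightarrow> eventually P G" for P
      unfolding B(3)[symmetric] eventually_tails[OF dir] eventually_tails[OF B(1)]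
      using ne reflA by (simp add: D_def le_def \<psi>_def) blast
    have eqs: "tails D le \<phi> = F" "tails D le \<psi> = G"
      using ev\<phi> ev\<psi> by (simp_all add: filter_eq_iff)
    have mix: "\<forall>d\<in>D. \<rho> d \<in> {\<phi> d, \<psi> d}" by (simp add: \<rho>_def)
    have "eventually P (sup F G)" if "eventually P (tails D le \<rho>)" for P
    proof -
      from that obtain a b i where d: "a \<in> A" "b \<in> B"
        "\<forall>e\<in>D. le (a, b, i) e \<longrightarrow> P (\<rho> e)"
        unfolding eventually_tails[OF dir] by (auto simp: D_def)
      have "P (\<alpha> a')" if "a' \<in> A" "leA a a'" for a'
        using d that reflB[OF d(2)] bspec[OF d(3), of "(a', b, True)"]
        by (simp add: D_def le_def \<rho>_def \<phi>_def)
      moreover have "P (\<beta> b')" if "b' \<in> B" "leB b b'" for b'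
        using d that reflA[OF d(1)] bspec[OF d(3), of "(a, b', False)"]
        by (simp add: D_def le_def \<rho>_def \<psi>_def)
      ultimately show ?thesis
        unfolding eventually_sup A(3)[symmetric] B(3)[symmetric]
          eventually_tails[OF A(1)] eventually_tails[OF B(1)] using d(1,2) by blast
    qed
    then have "sup F G \<le> tails D le \<rho>" by (rule filter_leI)
    then have "tails D le \<rho> = sup F G"
      using mixing_tails_le[OF dir mix] by (simp add: eqs antisym)
    moreover have "\<phi> \<in> D \<rightarrow> X" "\<psi> \<in> D \<rightarrow> X"
      using A(2) B(2) by (auto simp: D_def \<phi>_def \<psi>_def)
    then have "x \<in> L (tails D le \<rho>)"
      using st[unfolded stable_def, rule_format, of D le \<phi> \<psi> \<rho> x] dir mix x eqs by simp
    ultimately show "x \<in> L (sup F G)" by simp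
  qed
next
  assume r: "\<forall>F G. proper_on X F \<and> proper_on X G \<longrightarrow> L F \<inter> L G \<subseteq> L (sup F G)"
  show "stable X L"
    unfolding stable_def
  proof (intro allI impI; elim conjE)
    fix D :: "'a net_index set" and le \<phi> \<psi> \<rho> x
    assume h: "directed_preorder D le" "\<phi> \<in> D \<rightarrow> X" "\<psi> \<in> D \<rightarrow> X" "\<forall>d\<in>D. \<rho> d \<in> {\<phi> d, \<psi> d}"
      "x \<in> L (tails D le \<phi>)" "x \<in> L (tails D le \<psi>)"
    have "\<rho> \<in> D \<rightarrow> X" using h(2-4) by fastforce
    then have p: "proper_on X (tails D le \<phi>)" "proper_on X (tails D le \<psi>)"
      "proper_on X (tails D le \<rho>)"
      using h proper_on_tails by blast+
    then have "proper_on X (sup (tails D le \<phi>) (tails D le \<psi>))"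
      by (auto simp: proper_on_def)
    then have "L (sup (tails D le \<phi>) (tails D le \<psi>)) \<subseteq> L (tails D le \<rho>)"
      using assms[unfolded isotone_def, rule_format] p(3) mixing_tails_le[OF h(1,4)] by simp
    moreover have "x \<in> L (sup (tails D le \<phi>) (tails D le \<psi>))"
      using r[rule_format, OF conjI[OF p(1,2)]] h(5,6) by (simp add: subset_iff)
    ultimately show "x \<in> L (tails D le \<rho>)" by (rule subsetD)
  qed
qed

lemma stable_nets:
  fixes D :: "'i set"
  assumes "isotone X L" "stable X L" "directed_preorder D le" "\<phi> \<in> D \<rightarrow> X" "\<psi> \<in> D \<rightarrow> X"
    "\<forall>d\<in>D. \<rho> d \<in> {\<phi> d, \<psi> d}" "x \<in> L (tails D le \<phi>)" "x \<in> L (tails D le \<psi>)"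
  shows "x \<in> L (tails D le \<rho>)"
proof -
  have "\<rho> \<in> D \<rightarrow> X" using assms(4-6) by fastforce
  then have p: "proper_on X (tails D le \<phi>)" "proper_on X (tails D le \<psi>)"
    "proper_on X (tails D le \<rho>)"
    using assms proper_on_tails by blast+
  then have "proper_on X (sup (tails D le \<phi>) (tails D le \<psi>))"
    by (auto simp: proper_on_def)
  then have "L (sup (tails D le \<phi>) (tails D le \<psi>)) \<subseteq> L (tails D le \<rho>)"
    using assms(1)[unfolded isotone_def, rule_format] p(3) mixing_tails_le[OF assms(3,6)] by simp
  moreover have "x \<in> L (sup (tails D le \<phi>) (tails D le \<psi>))"
    using assms(2)[unfolded stable_iff[OF assms(1)], rule_format, OF conjI[OF p(1,2)]] assms(7,8)
    by (simp add: subset_iff)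
  ultimately show ?thesis by (rule subsetD)
qed

definition conv_continuous ::
  "'a set \<Rightarrow> ('a filter \<Rightarrow> 'a set) \<Rightarrow> 'b set \<Rightarrow> ('b filter \<Rightarrow> 'b set) \<Rightarrow> ('a \<Rightarrow> 'b) \<Rightarrow> bool" where
  "conv_continuous X L Y M f \<longleftrightarrow> f \<in> X \<rightarrow> Y \<and>
     (\<forall>F x. proper_on X F \<and> x \<in> X \<and> x \<in> L F \<longrightarrow> f x \<in> M (filtermap f F))"

definition subspace_conv :: "('a filter \<Rightarrow> 'a set) \<Rightarrow> 'a set \<Rightarrow> 'a filter \<Rightarrow> 'a set" where
  "subspace_conv L U F = L F \<inter> U"

definition top_conv :: "'a::topological_space set \<Rightarrow> 'a filter \<Rightarrow> 'a set" where
  "top_conv Y F = {y\<in>Y. F \<le> nhds y}"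

definition convergence_system ::
  "'a set \<Rightarrow> ('a filter \<Rightarrow> 'a set) \<Rightarrow> 'a set set \<Rightarrow> bool" where
  "convergence_system X L \<C> \<longleftrightarrow> (\<forall>C\<in>\<C>. C \<subseteq> X) \<and>
     (\<forall>x\<in>X. \<forall>F. proper_on X F \<and> x \<in> L F \<longrightarrow> (\<exists>C\<in>\<C>. eventually (\<lambda>y. y \<in> C) F))"

text \<open>
  Maps defined on a subset are made extensional, so that equality of maps is equality on that subset.
\<close>

definition cont_maps ::
  "'b set \<Rightarrow> ('b filter \<Rightarrow> 'b set) \<Rightarrow> 'a set \<Rightarrow> ('a filter \<Rightarrow> 'a set) \<Rightarrow> ('b \<Rightarrow> 'a) set" where
  "cont_maps Y M X L = {f \<in> extensional Y. conv_continuous Y M X L f}"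

text \<open>
  By \<open>tails_Times\<close> and \<open>filtermap_tails\<close>, the filter below is that of the net
  \<open>f\<^sub>a (y\<^sub>b)\<close> indexed by the product preorder if \<open>\<Phi>\<close> and \<open>G\<close> are those of \<open>f\<^sub>a\<close> and \<open>y\<^sub>b\<close>.
\<close>

definition continuous_conv ::
  "'b set \<Rightarrow> ('b filter \<Rightarrow> 'b set) \<Rightarrow> 'a set \<Rightarrow> ('a filter \<Rightarrow> 'a set) \<Rightarrow>
   ('b \<Rightarrow> 'a) filter \<Rightarrow> ('b \<Rightarrow> 'a) set" where
  "continuous_conv Y M X L \<Phi> = {f \<in> cont_maps Y M X L.
     \<forall>G y. proper_on Y G \<and> y \<in> Y \<and> y \<in> M G \<longrightarrow> f y \<in> L (filtermap (\<lambda>(g, z). g z) (\<Phi> \<times>\<^sub>F G))}"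


section \<open>Groupoids and their colimits\<close>

record ('o, 'm) cat =
  Obj :: "'o set"
  Arr :: "'m set"
  Dom :: "'m \<Rightarrow> 'o"
  Cod :: "'m \<Rightarrow> 'o"
  Id :: "'o \<Rightarrow> 'm"
  Comp :: "'m \<Rightarrow> 'm \<Rightarrow> 'm"

text \<open>\<open>Comp C g f\<close> is the composite of \<open>f\<close> followed by \<open>g\<close>.\<close>

definition is_category :: "('o, 'm) cat \<Rightarrow> bool" where
  "is_category C \<longleftrightarrow>
     (\<forall>f\<in>Arr C. Dom C f \<in> Obj C \<and> Cod C f \<in> Obj C) \<and>
     (\<forall>x\<in>Obj C. Id C x \<in> Arr C \<and> Dom C (Id C x) = x \<and> Cod C (Id C x) = x) \<and>
     (\<forall>f\<in>Arr C. \<forall>g\<in>Arr C. Cod C f = Dom C g \<longrightarrow>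
        Comp C g f \<in> Arr C \<and> Dom C (Comp C g f) = Dom C f \<and> Cod C (Comp C g f) = Cod C g) \<and>
     (\<forall>f\<in>Arr C. Comp C f (Id C (Dom C f)) = f \<and> Comp C (Id C (Cod C f)) f = f) \<and>
     (\<forall>f\<in>Arr C. \<forall>g\<in>Arr C. \<forall>h\<in>Arr C. Cod C f = Dom C g \<and> Cod C g = Dom C h \<longrightarrow>
        Comp C h (Comp C g f) = Comp C (Comp C h g) f)"

definition is_groupoid :: "('o, 'm) cat \<Rightarrow> bool" where
  "is_groupoid C \<longleftrightarrow> is_category C \<and>
     (\<forall>f\<in>Arr C. \<exists>g\<in>Arr C. Dom C g = Cod C f \<and> Cod C g = Dom C f \<and>
        Comp C g f = Id C (Dom C f) \<and> Comp C f g = Id C (Cod C f))"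

record ('o, 'm, 'p, 'n) cat_map =
  on_obj :: "'o \<Rightarrow> 'p"
  on_arr :: "'m \<Rightarrow> 'n"

text \<open>
  Both components are extensional, so that equality of functors is equality on objects and arrows.
\<close>

definition is_functor ::
  "('o, 'm) cat \<Rightarrow> ('p, 'n) cat \<Rightarrow> ('o, 'm, 'p, 'n) cat_map \<Rightarrow> bool" where
  "is_functor C D T \<longleftrightarrow>
     on_obj T \<in> Obj C \<rightarrow>\<^sub>E Obj D \<and> on_arr T \<in> Arr C \<rightarrow>\<^sub>E Arr D \<and>
     (\<forall>f\<in>Arr C. Dom D (on_arr T f) = on_obj T (Dom C f) \<and>
        Cod D (on_arr T f) = on_obj T (Cod C f)) \<and>
     (\<forall>x\<in>Obj C. on_arr T (Id C x) = Id D (on_obj T x)) \<and>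
     (\<forall>f\<in>Arr C. \<forall>g\<in>Arr C. Cod C f = Dom C g \<longrightarrow>
        on_arr T (Comp C g f) = Comp D (on_arr T g) (on_arr T f))"

definition id_functor :: "('o, 'm) cat \<Rightarrow> ('o, 'm, 'o, 'm) cat_map" where
  "id_functor C = \<lparr>on_obj = (\<lambda>x\<in>Obj C. x), on_arr = (\<lambda>f\<in>Arr C. f)\<rparr>"

definition comp_functor ::
  "('o, 'm) cat \<Rightarrow> ('p, 'n, 'q, 'l) cat_map \<Rightarrow> ('o, 'm, 'p, 'n) cat_map \<Rightarrow>
   ('o, 'm, 'q, 'l) cat_map" where
  "comp_functor C S T =
     \<lparr>on_obj = compose (Obj C) (on_obj S) (on_obj T),
      on_arr = compose (Arr C) (on_arr S) (on_arr T)\<rparr>"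

text \<open>A functor from the category \<open>J\<close> to the category of groupoids.\<close>

definition groupoid_diagram ::
  "('j, 'k) cat \<Rightarrow> ('j \<Rightarrow> ('o, 'm) cat) \<Rightarrow> ('k \<Rightarrow> ('o, 'm, 'o, 'm) cat_map) \<Rightarrow> bool" where
  "groupoid_diagram J D T \<longleftrightarrow> is_category J \<and>
     (\<forall>j\<in>Obj J. is_groupoid (D j)) \<and>
     (\<forall>u\<in>Arr J. is_functor (D (Dom J u)) (D (Cod J u)) (T u)) \<and>
     (\<forall>j\<in>Obj J. T (Id J j) = id_functor (D j)) \<and>
     (\<forall>u\<in>Arr J. \<forall>v\<in>Arr J. Cod J u = Dom J v \<longrightarrow>
        T (Comp J v u) = comp_functor (D (Dom J u)) (T v) (T u))"

definition groupoid_cocone ::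
  "('j, 'k) cat \<Rightarrow> ('j \<Rightarrow> ('o, 'm) cat) \<Rightarrow> ('k \<Rightarrow> ('o, 'm, 'o, 'm) cat_map) \<Rightarrow>
   ('p, 'n) cat \<Rightarrow> ('j \<Rightarrow> ('o, 'm, 'p, 'n) cat_map) \<Rightarrow> bool" where
  "groupoid_cocone J D T G c \<longleftrightarrow> is_groupoid G \<and>
     (\<forall>j\<in>Obj J. is_functor (D j) G (c j)) \<and>
     (\<forall>u\<in>Arr J. comp_functor (D (Dom J u)) (c (Cod J u)) (T u) = c (Dom J u))"

text \<open>
  The first argument only names the types over which the competing cocones range. A theorem in
  which these types are variables states the universal property with respect to all groupoids.
\<close>

definition is_groupoid_colimit ::
  "('q, 'l) cat itself \<Rightarrow>
   ('j, 'k) cat \<Rightarrow> ('j \<Rightarrow> ('o, 'm) cat) \<Rightarrow> ('k \<Rightarrow> ('o, 'm, 'o, 'm) cat_map) \<Rightarrow>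
   ('p, 'n) cat \<Rightarrow> ('j \<Rightarrow> ('o, 'm, 'p, 'n) cat_map) \<Rightarrow> bool" where
  "is_groupoid_colimit TYPE_K J D T G c \<longleftrightarrow>
     groupoid_diagram J D T \<and> groupoid_cocone J D T G c \<and>
     (\<forall>(K :: ('q, 'l) cat) k. groupoid_cocone J D T K k \<longrightarrow>
        (\<exists>!S. is_functor G K S \<and> (\<forall>j\<in>Obj J. comp_functor (D j) S (c j) = k j)))"

definition inclusion_category :: "'a set set \<Rightarrow> ('a set, 'a set \<times> 'a set) cat" where
  "inclusion_category \<O> =
     \<lparr>Obj = \<O>, Arr = {(U, V). U \<in> \<O> \<and> V \<in> \<O> \<and> U \<subseteq> V}, Dom = fst, Cod = snd,
      Id = (\<lambda>U. (U, U)), Comp = (\<lambda>v u. (fst u, snd v))\<rparr>"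


section \<open>The fundamental groupoid\<close>

definition conv_paths ::
  "'a set \<Rightarrow> ('a filter \<Rightarrow> 'a set) \<Rightarrow> 'a \<Rightarrow> 'a \<Rightarrow> (real \<Rightarrow> 'a) set" where
  "conv_paths X L x y =
     {\<gamma> \<in> cont_maps {0..1} (top_conv {0..1}) X L. \<gamma> 0 = x \<and> \<gamma> 1 = y}"

definition rel_homotopic ::
  "'a set \<Rightarrow> ('a filter \<Rightarrow> 'a set) \<Rightarrow> 'a \<Rightarrow> 'a \<Rightarrow> (real \<Rightarrow> 'a) \<Rightarrow> (real \<Rightarrow> 'a) \<Rightarrow> bool" where
  "rel_homotopic X L x y \<gamma> \<gamma>' \<longleftrightarrow> \<gamma> \<in> conv_paths X L x y \<and> \<gamma>' \<in> conv_paths X L x y \<and>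
     (\<exists>H. conv_continuous {0..1} (top_conv {0..1})
            (cont_maps {0..1} (top_conv {0..1}) X L)
            (continuous_conv {0..1} (top_conv {0..1}) X L) H \<and>
          H 0 = \<gamma> \<and> H 1 = \<gamma>' \<and> (\<forall>t\<in>{0..1::real}. H t \<in> conv_paths X L x y))"

definition hclass ::
  "'a set \<Rightarrow> ('a filter \<Rightarrow> 'a set) \<Rightarrow> 'a \<Rightarrow> 'a \<Rightarrow> (real \<Rightarrow> 'a) \<Rightarrow> (real \<Rightarrow> 'a) set" where
  "hclass X L x y \<gamma> = {\<gamma>'. rel_homotopic X L x y \<gamma> \<gamma>'}"

definition conv_join :: "(real \<Rightarrow> 'a) \<Rightarrow> (real \<Rightarrow> 'a) \<Rightarrow> real \<Rightarrow> 'a" where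
  "conv_join \<gamma> \<rho> = (\<lambda>t\<in>{0..1}. if t \<le> 1/2 then \<gamma> (2 * t) else \<rho> (2 * t - 1))"

text \<open>
  An arrow \<open>x \<rightarrow> y\<close> is a triple \<open>(x, c, y)\<close> with \<open>c\<close> a homotopy class of paths from \<open>x\<close> to \<open>y\<close>.
  An operation defined through representatives is written as the union of the resulting classes
  over all representatives; since these classes all coincide, the union is that class.
\<close>

type_synonym 'a pi_arrow = "'a \<times> (real \<Rightarrow> 'a) set \<times> 'a"

definition fundamental_groupoid ::
  "'a set \<Rightarrow> ('a filter \<Rightarrow> 'a set) \<Rightarrow> ('a, 'a pi_arrow) cat" where
  "fundamental_groupoid X L =
     \<lparr>Obj = X,
      Arr = {(x, hclass X L x y \<gamma>, y) |x y \<gamma>. x \<in> X \<and> y \<in> X \<and> \<gamma> \<in> conv_paths X L x y},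
      Dom = (\<lambda>(x, c, y). x),
      Cod = (\<lambda>(x, c, y). y),
      Id = (\<lambda>x. (x, hclass X L x x (\<lambda>t\<in>{0..1}. x), x)),
      Comp = (\<lambda>(y', d, z) (x, c, y).
        (x, \<Union>\<gamma>\<in>c. \<Union>\<rho>\<in>d. hclass X L x z (conv_join \<gamma> \<rho>), z))\<rparr>"

definition fundamental_functor ::
  "'a set \<Rightarrow> ('a filter \<Rightarrow> 'a set) \<Rightarrow> 'b set \<Rightarrow> ('b filter \<Rightarrow> 'b set) \<Rightarrow> ('a \<Rightarrow> 'b) \<Rightarrow>
   ('a, 'a pi_arrow, 'b, 'b pi_arrow) cat_map" where
  "fundamental_functor X L Y M f =
     \<lparr>on_obj = (\<lambda>x\<in>X. f x),
      on_arr = (\<lambda>(x, c, y)\<in>Arr (fundamental_groupoid X L).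
        (f x, \<Union>\<gamma>\<in>c. hclass Y M (f x) (f y) (compose {0..1} f \<gamma>), f y))\<rparr>"

end

theory Submission
  imports Defs
begin

text \<open>
  The argument is the one of the groupoid version of the van Kampen theorem. All the topology it
  uses is the topology of \<open>[0,1]\<close> and of the unit square. A continuous map \<open>f\<close> from such a space sends
  the neighbourhood filter of a point \<open>s\<close> to a filter that converges to \<open>f s\<close>, so this filter contains
  a member of the convergence system, which means that \<open>f\<close> maps a neighbourhood of \<open>s\<close> into a member.
  By compactness (\<open>convergence_system_Lebesgue\<close>) a sufficiently fine uniform grid of the interval or
  of the square therefore has all its cells mapped into members. Two points make this applicable
  although \<open>X\<close> has no topology: stability of the limit space yields gluing of continuous maps along
  closed sets (\<open>lim_continuous_on_Un\<close>), hence concatenation of paths and homotopies; and continuity of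
  a homotopy with respect to continuous convergence is the same as continuity on the square
  (\<open>rel_homotopic_iff\<close>).

  All identities of the fundamental groupoid come from one fact: if \<open>f\<close> is continuous on a convex set,
  the images under \<open>f\<close> of the segments \<open>p q\<close> and \<open>q r\<close> compose to the image of \<open>p r\<close>
  (\<open>Comp_segments\<close>). It gives the groupoid laws, the decomposition of a path into its pieces, and the
  commutativity of the small squares of a homotopy.

  Now let a cocone over the members with vertex \<open>K\<close> be given. A path that stays in some member has a
  value in \<open>K\<close>; two members that contain it give the same value, since both values agree with the
  one given by their intersection (\<open>local_arrow_eq\<close>). The value of an arbitrary path is the composite
  of the values of the \<open>N\<close> pieces of a uniform subdivision subordinate to the convergence system. It
  does not depend on \<open>N\<close>, because \<open>N\<close> and \<open>M\<close> have the common refinement \<open>N * M\<close>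
  (\<open>path_value_refine\<close>). It depends only on the homotopy class, because a homotopy can be cut into a
  grid of squares each of which lies in a member, and each row of the grid has the same composite
  as the next one (\<open>path_value_homotopic\<close>). Concatenation of two paths with \<open>N\<close> pieces is a path with
  \<open>2 N\<close> pieces, which gives functoriality. The functor is unique because in the fundamental groupoid
  every arrow is the composite of its pieces, and on pieces its value is prescribed.
\<close>

section \<open>Continuous maps from topological spaces to limit spaces\<close>

abbreviation nbhds_in :: "'b::topological_space set \<Rightarrow> 'b \<Rightarrow> 'b filter" where
  "nbhds_in S s \<equiv> inf (nhds s) (principal S)"

text \<open>
  Neighbourhood filters suffice to test continuity: every filter that converges to \<open>s\<close> in \<open>S\<close> is
  finer, and convergence in a limit space passes to finer filters
  (\<open>conv_continuous_iff_lim_continuous_on\<close>).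
\<close>

definition lim_continuous_on ::
  "'b::topological_space set \<Rightarrow> 'a set \<Rightarrow> ('a filter \<Rightarrow> 'a set) \<Rightarrow> ('b \<Rightarrow> 'a) \<Rightarrow> bool" where
  "lim_continuous_on S X L f \<longleftrightarrow>
     f \<in> S \<rightarrow> X \<and> (\<forall>s\<in>S. f s \<in> L (filtermap f (nbhds_in S s)))"

text \<open>
  Filters of a limit space are compared only among proper ones, so properness has to be carried
  along wherever a neighbourhood filter is mapped.
\<close>

lemma nbhds_in_neq_bot: "s \<in> S \<Longrightarrow> nbhds_in S s \<noteq> bot"
  unfolding trivial_limit_def eventually_inf_principal
  by (auto dest: eventually_nhds_x_imp_x)

lemma filtermap_nbhds_in_cong:
  assumes "\<And>s. s \<in> S \<Longrightarrow> f s = g s" "F \<le> principal S"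
  shows "filtermap f F = filtermap g F"
proof -
  have "eventually (\<lambda>s. s \<in> S) F" using assms(2) by (simp add: le_principal)
  then show ?thesis unfolding filter_eq_iff eventually_filtermap
    using assms(1) by (auto elim: eventually_elim2)
qed

lemma lim_continuous_on_cong:
  assumes "lim_continuous_on S X L f" "\<And>s. s \<in> S \<Longrightarrow> f s = g s"
  shows "lim_continuous_on S X L g"
proof -
  have "filtermap f (nbhds_in S s) = filtermap g (nbhds_in S s)" for s
    using assms(2) by (intro filtermap_nbhds_in_cong[of S]) auto
  moreover have "g \<in> S \<rightarrow> X"
    using assms by (auto simp: lim_continuous_on_def Pi_iff)
  ultimately show ?thesis
    using assms by (auto simp: lim_continuous_on_def)
qed

lemma limit_space_mono:
  assumes "limit_space X L" "proper_on X F" "G \<le> F" "G \<noteq> bot" "x \<in> L F"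
  shows "x \<in> L G"
proof -
  have "proper_on X G" using assms by (auto simp: proper_on_def)
  then show ?thesis using assms unfolding limit_space_def isotone_def by blast
qed

lemma limit_space_sup:
  assumes "limit_space X L" "proper_on X F" "proper_on X G" "x \<in> L F" "x \<in> L G"
  shows "x \<in> L (sup F G)"
  using assms stable_iff[of X L] unfolding limit_space_def by blast

lemma proper_on_filtermap:
  assumes "F \<noteq> bot" "F \<le> principal S" "f \<in> S \<rightarrow> X"
  shows "proper_on X (filtermap f F)"
  using assms unfolding proper_on_def
  by (auto simp: filtermap_bot_iff le_principal eventually_filtermap Pi_iff elim: eventually_mono)

lemma lim_continuous_onD:
  assumes "limit_space X L" "lim_continuous_on S X L f" "s \<in> S" "F \<le> nbhds_in S s" "F \<noteq> bot"
  shows "f s \<in> L (filtermap f F)"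
proof (rule limit_space_mono[OF assms(1)])
  show "proper_on X (filtermap f (nbhds_in S s))"
    using assms(2,3) nbhds_in_neq_bot
    by (intro proper_on_filtermap[where S = S]) (auto simp: lim_continuous_on_def)
  show "filtermap f F \<le> filtermap f (nbhds_in S s)" by (rule filtermap_mono[OF assms(4)])
  show "filtermap f F \<noteq> bot" using assms(5) by (simp add: filtermap_bot_iff)
  show "f s \<in> L (filtermap f (nbhds_in S s))" using assms(2,3) by (simp add: lim_continuous_on_def)
qed

lemma conv_continuous_iff_lim_continuous_on:
  assumes "limit_space X L"
  shows "conv_continuous S (top_conv S) X L f \<longleftrightarrow> lim_continuous_on S X L f"
proof
  assume c: "conv_continuous S (top_conv S) X L f"
  have "f s \<in> L (filtermap f (nbhds_in S s))" if "s \<in> S" for s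
  proof -
    have "proper_on S (nbhds_in S s)" "s \<in> top_conv S (nbhds_in S s)"
      using that by (auto simp: proper_on_def top_conv_def nbhds_in_neq_bot)
    then show ?thesis using c that by (simp add: conv_continuous_def)
  qed
  then show "lim_continuous_on S X L f"
    using c by (simp add: lim_continuous_on_def conv_continuous_def)
next
  assume c: "lim_continuous_on S X L f"
  then show "conv_continuous S (top_conv S) X L f"
    using lim_continuous_onD[OF assms c]
    by (auto simp: conv_continuous_def lim_continuous_on_def proper_on_def top_conv_def)
qed

lemma filtermap_nbhds_in_le:
  assumes "continuous_on T g" "g \<in> T \<rightarrow> S" "t \<in> T"
  shows "filtermap g (nbhds_in T t) \<le> nbhds_in S (g t)"
proof (rule filter_leI)
  fix P assume "eventually P (nbhds_in S (g t))"
  then have ev: "eventually (\<lambda>x. x \<in> S \<longrightarrow> P x) (nhds (g t))"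
    by (simp add: eventually_inf_principal)
  have "(g \<longlongrightarrow> g t) (at t within T)" using assms by (simp add: continuous_on_def)
  then have "eventually (\<lambda>y. g y \<in> S \<longrightarrow> P (g y)) (at t within T)"
    using ev by (auto simp: filterlim_iff)
  then have "eventually (\<lambda>y. y \<noteq> t \<longrightarrow> y \<in> T \<longrightarrow> P (g y)) (nhds t)"
    using assms(2) by (auto simp: eventually_at_filter elim!: eventually_mono)
  moreover have "P (g t)" using eventually_nhds_x_imp_x[OF ev] assms by auto
  ultimately show "eventually P (filtermap g (nbhds_in T t))"
    unfolding eventually_filtermap eventually_inf_principal by (auto elim!: eventually_mono)
qed

lemma lim_continuous_on_compose:
  assumes "limit_space X L" "lim_continuous_on S X L f" "continuous_on T g" "g \<in> T \<rightarrow> S"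
  shows "lim_continuous_on T X L (\<lambda>t. f (g t))"
  unfolding lim_continuous_on_def
proof (intro conjI ballI)
  show "(\<lambda>t. f (g t)) \<in> T \<rightarrow> X" using assms(2,4) by (auto simp: lim_continuous_on_def)
  fix t assume t: "t \<in> T"
  have "f (g t) \<in> L (filtermap f (filtermap g (nbhds_in T t)))"
    using t assms(4) nbhds_in_neq_bot[OF t]
    by (intro lim_continuous_onD[OF assms(1,2) _ filtermap_nbhds_in_le[OF assms(3,4) t]])
       (auto simp: filtermap_bot_iff)
  then show "f (g t) \<in> L (filtermap (\<lambda>t. f (g t)) (nbhds_in T t))"
    by (simp add: filtermap_filtermap)
qed

lemma lim_continuous_on_subset:
  assumes "limit_space X L" "lim_continuous_on S X L f" "T \<subseteq> S"
  shows "lim_continuous_on T X L f"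
  using lim_continuous_on_compose[OF assms(1,2), of T "\<lambda>t. t"] assms(3) by auto

lemma lim_continuous_on_const:
  assumes "limit_space X L" "x \<in> X"
  shows "lim_continuous_on S X L (\<lambda>_. x)"
proof -
  have "filtermap (\<lambda>_. x) (nbhds_in S s) = principal {x}" if "s \<in> S" for s
    using nbhds_in_neq_bot[OF that]
    by (auto simp: filter_eq_iff eventually_filtermap eventually_principal)
  then show ?thesis
    using assms by (auto simp: lim_continuous_on_def limit_space_def centered_def)
qed

lemma lim_continuous_on_conv_continuous:
  assumes "limit_space X L" "lim_continuous_on S X L f" "conv_continuous X L Y M g"
  shows "lim_continuous_on S Y M (\<lambda>s. g (f s))"
  unfolding lim_continuous_on_def
proof (intro conjI ballI)
  show "(\<lambda>s. g (f s)) \<in> S \<rightarrow> Y" using assms(2,3) 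
    by (auto simp: lim_continuous_on_def conv_continuous_def)
  fix s assume s: "s \<in> S"
  have "proper_on X (filtermap f (nbhds_in S s))"
    using assms(2) nbhds_in_neq_bot[OF s]
    by (intro proper_on_filtermap[where S = S]) (auto simp: lim_continuous_on_def)
  moreover have "f s \<in> X" "f s \<in> L (filtermap f (nbhds_in S s))"
    using assms(2) s by (auto simp: lim_continuous_on_def)
  ultimately have "g (f s) \<in> M (filtermap g (filtermap f (nbhds_in S s)))"
    using assms(3) by (auto simp: conv_continuous_def)
  then show "g (f s) \<in> M (filtermap (\<lambda>s. g (f s)) (nbhds_in S s))"
    by (simp add: filtermap_filtermap)
qed

lemma conv_continuous_compose:
  assumes f: "conv_continuous X L Y M f" and g: "conv_continuous Y M Z N g"
  shows "conv_continuous X L Z N (\<lambda>x. g (f x))"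
  unfolding conv_continuous_def
proof (intro conjI allI impI)
  have fY: "f \<in> X \<rightarrow> Y" using f by (simp add: conv_continuous_def)
  then show "(\<lambda>x. g (f x)) \<in> X \<rightarrow> Z" using g by (auto simp: conv_continuous_def)
  fix F x assume F: "proper_on X F \<and> x \<in> X \<and> x \<in> L F"
  then have "f x \<in> M (filtermap f F)" using f by (simp add: conv_continuous_def)
  moreover have "proper_on Y (filtermap f F)" "f x \<in> Y"
    using F fY proper_on_filtermap[of F X f Y] by (auto simp: proper_on_def)
  ultimately have "g (f x) \<in> N (filtermap g (filtermap f F))"
    using g by (simp add: conv_continuous_def)
  then show "g (f x) \<in> N (filtermap (\<lambda>x. g (f x)) F)" by (simp add: filtermap_filtermap)
qed

lemma nbhds_in_closed_eq_bot:
  assumes "closed A" "s \<notin> A"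
  shows "nbhds_in A s = bot"
proof -
  have "eventually (\<lambda>x. x \<in> - A) (nhds s)"
    using assms by (intro eventually_nhds_in_open) auto
  then show ?thesis
    by (simp add: trivial_limit_def eventually_inf_principal)
qed

text \<open>
  Near a point of both sets, the neighbourhood filter in the union is the supremum of those in the
  two parts, so this is where stability enters. Near a point of only one of them, the other part
  contributes the improper filter, because it is closed.
\<close>

lemma lim_continuous_on_Un:
  assumes lim: "limit_space X L" and "closed A" "closed B"
    and fA: "lim_continuous_on A X L f" and fB: "lim_continuous_on B X L f"
  shows "lim_continuous_on (A \<union> B) X L f"
  unfolding lim_continuous_on_def
proof (intro conjI ballI)
  show "f \<in> A \<union> B \<rightarrow> X" using fA fB by (auto simp: lim_continuous_on_def)
  fix s assume s: "s \<in> A \<union> B"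
  have sup: "nbhds_in (A \<union> B) s = sup (nbhds_in A s) (nbhds_in B s)"
    by (auto simp: filter_eq_iff eventually_sup eventually_inf_principal
        elim: eventually_elim2 eventually_mono)
  have proper: "proper_on X (filtermap f (nbhds_in C s))"
    if "s \<in> C" "lim_continuous_on C X L f" for C
    using that nbhds_in_neq_bot[OF that(1)]
    by (intro proper_on_filtermap[where S = C]) (auto simp: lim_continuous_on_def)
  have conv: "f s \<in> L (filtermap f (nbhds_in C s))"
    if "s \<in> C" "lim_continuous_on C X L f" for C
    using that by (auto simp: lim_continuous_on_def)
  consider "s \<in> A" "s \<in> B" | "s \<in> A" "s \<notin> B" | "s \<notin> A" "s \<in> B" using s by blast
  then show "f s \<in> L (filtermap f (nbhds_in (A \<union> B) s))"
  proof cases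
    case 1
    then show ?thesis
      unfolding sup filtermap_sup
      using proper conv fA fB by (intro limit_space_sup[OF lim]) auto
  next
    case 2
    then show ?thesis
      using conv[OF _ fA] nbhds_in_closed_eq_bot[OF \<open>closed B\<close>] by (simp add: sup)
  next
    case 3
    then show ?thesis
      using conv[OF _ fB] nbhds_in_closed_eq_bot[OF \<open>closed A\<close>] by (simp add: sup)
  qed
qed

lemma lim_continuous_on_cases:
  fixes u :: "'b::topological_space \<Rightarrow> real"
  assumes lim: "limit_space X L" and "closed S" "continuous_on S u"
    and f: "lim_continuous_on {s\<in>S. u s \<le> c} X L f"
    and g: "lim_continuous_on {s\<in>S. c \<le> u s} X L g"
    and eq: "\<And>s. s \<in> S \<Longrightarrow> u s = c \<Longrightarrow> f s = g s"
  shows "lim_continuous_on S X L (\<lambda>s. if u s \<le> c then f s else g s)" (is "lim_continuous_on _ _ _ ?h")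
proof -
  have "closed {s\<in>S. u s \<le> c}" "closed {s\<in>S. c \<le> u s}"
    using assms(2,3) continuous_on_const by (auto intro: closed_Collect_le continuous_on_closed_Collect_le)
  moreover have "lim_continuous_on {s\<in>S. u s \<le> c} X L ?h"
    by (rule lim_continuous_on_cong[OF f]) auto
  moreover have "lim_continuous_on {s\<in>S. c \<le> u s} X L ?h"
    by (rule lim_continuous_on_cong[OF g]) (use eq in auto)
  ultimately have "lim_continuous_on ({s\<in>S. u s \<le> c} \<union> {s\<in>S. c \<le> u s}) X L ?h"
    by (intro lim_continuous_on_Un[OF lim])
  moreover have "{s\<in>S. u s \<le> c} \<union> {s\<in>S. c \<le> u s} = S" by auto
  ultimately show ?thesis by simp
qed

lemma limit_space_subspace:
  assumes "limit_space X L" "U \<subseteq> X"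
  shows "limit_space U (subspace_conv L U)"
proof -
  have proper: "proper_on X F" if "proper_on U F" for F
    using that assms(2) by (auto simp: proper_on_def le_principal elim: eventually_mono)
  have iso: "isotone U (subspace_conv L U)"
    using assms(1) proper unfolding limit_space_def isotone_def subspace_conv_def by blast
  moreover have "stable U (subspace_conv L U)"
    unfolding stable_iff[OF iso] subspace_conv_def
    using limit_space_sup[OF assms(1)] proper by blast
  ultimately show ?thesis
    using assms
    by (auto simp: limit_space_def preconvergence_def centered_def subspace_conv_def)
qed

lemma lim_continuous_on_subspace_iff:
  assumes "U \<subseteq> X"
  shows "lim_continuous_on S U (subspace_conv L U) f \<longleftrightarrow> lim_continuous_on S X L f \<and> f \<in> S \<rightarrow> U"
  using assms by (auto simp: lim_continuous_on_def subspace_conv_def)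

lemma conv_continuous_inclusion:
  assumes "U \<subseteq> V"
  shows "conv_continuous U (subspace_conv L U) V (subspace_conv L V) (\<lambda>x. x)"
  using assms by (auto simp: conv_continuous_def subspace_conv_def filtermap_ident)

lemma conv_continuous_inclusion_total:
  assumes "U \<subseteq> X"
  shows "conv_continuous U (subspace_conv L U) X L (\<lambda>x. x)"
  using assms by (auto simp: conv_continuous_def subspace_conv_def filtermap_ident)

section \<open>Homotopies as continuous maps on the square\<close>

lemma nbhds_in_Times: "nbhds_in (A \<times> B) (s, t) = nbhds_in A s \<times>\<^sub>F nbhds_in B t"
proof (rule antisym)
  show "nbhds_in (A \<times> B) (s, t) \<le> nbhds_in A s \<times>\<^sub>F nbhds_in B t"
  proof (rule le_prod_filterI)
    show "filtermap fst (nbhds_in (A \<times> B) (s, t)) \<le> nbhds_in A s"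
      unfolding nhds_prod le_inf_iff
    proof
      show "filtermap fst (inf (nhds s \<times>\<^sub>F nhds t) (principal (A \<times> B))) \<le> nhds s"
        by (rule order_trans[OF filtermap_mono[OF inf_le1] filtermap_fst_prod_filter])
    qed (auto simp: le_principal eventually_filtermap eventually_inf_principal
        intro: always_eventually)
    show "filtermap snd (nbhds_in (A \<times> B) (s, t)) \<le> nbhds_in B t"
      unfolding nhds_prod le_inf_iff
    proof
      show "filtermap snd (inf (nhds s \<times>\<^sub>F nhds t) (principal (A \<times> B))) \<le> nhds t"
        by (rule order_trans[OF filtermap_mono[OF inf_le1] filtermap_snd_prod_filter])
    qed (auto simp: le_principal eventually_filtermap eventually_inf_principal
        intro: always_eventually)
  qed
  show "nbhds_in A s \<times>\<^sub>F nbhds_in B t \<le> nbhds_in (A \<times> B) (s, t)"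
    unfolding nhds_prod
  proof (rule le_infI)
    show "nbhds_in A s \<times>\<^sub>F nbhds_in B t \<le> nhds s \<times>\<^sub>F nhds t"
      by (intro prod_filter_mono) auto
    have "nbhds_in A s \<times>\<^sub>F nbhds_in B t \<le> principal A \<times>\<^sub>F principal B"
      by (intro prod_filter_mono) auto
    also have "\<dots> = principal (A \<times> B)" by (rule principal_prod_principal)
    finally show "nbhds_in A s \<times>\<^sub>F nbhds_in B t \<le> principal (A \<times> B)" .
  qed
qed

abbreviation unit_square :: "(real \<times> real) set" where
  "unit_square \<equiv> {0..1} \<times> {0..1}"

lemma conv_paths_iff:
  assumes "limit_space X L"
  shows "\<gamma> \<in> conv_paths X L x y \<longleftrightarrow>
    \<gamma> \<in> extensional {0..1} \<and> lim_continuous_on {0..1} X L \<gamma> \<and> \<gamma> 0 = x \<and> \<gamma> 1 = y"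
  using conv_continuous_iff_lim_continuous_on[OF assms]
  by (auto simp: conv_paths_def cont_maps_def)

text \<open>
  Evaluating the image of the neighbourhood filter of \<open>s\<close> under \<open>H\<close> on the neighbourhood filter of \<open>t\<close>
  gives the image of the product filter under the uncurried map, and the product filter is the
  neighbourhood filter of \<open>(s, t)\<close> in the square.
\<close>

lemma rel_homotopic_iff:
  assumes lim: "limit_space X L"
  shows "rel_homotopic X L x y \<gamma> \<gamma>' \<longleftrightarrow>
    \<gamma> \<in> conv_paths X L x y \<and> \<gamma>' \<in> conv_paths X L x y \<and>
    (\<exists>h. lim_continuous_on unit_square X L h \<and>
      (\<forall>t\<in>{0..1}. h (0, t) = \<gamma> t \<and> h (1, t) = \<gamma>' t \<and> h (t, 0) = x \<and> h (t, 1) = y))"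
    (is "?R \<longleftrightarrow> ?P \<and> ?P' \<and> (\<exists>h. ?Q h)")
proof (rule iffI)
  let ?I = "{0..1::real}"
  assume R: ?R
  then obtain H where
    H: "conv_continuous ?I (top_conv ?I) (cont_maps ?I (top_conv ?I) X L)
          (continuous_conv ?I (top_conv ?I) X L) H"
    and H01: "H 0 = \<gamma>" "H 1 = \<gamma>'" and Hp: "\<And>t. t \<in> ?I \<Longrightarrow> H t \<in> conv_paths X L x y"
    by (auto simp: rel_homotopic_def)
  define h where "h = (\<lambda>(s, t). H s t)"
  have "H s t \<in> X" if "s \<in> ?I" "t \<in> ?I" for s t
    using Hp[OF that(1)] that(2) unfolding conv_paths_iff[OF lim] lim_continuous_on_def by blast
  then have hX: "h \<in> unit_square \<rightarrow> X"
    by (auto simp: h_def)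
  have "h (s, t) \<in> L (filtermap h (nbhds_in unit_square (s, t)))" if st: "s \<in> ?I" "t \<in> ?I" for s t
  proof -
    have p: "proper_on ?I (nbhds_in ?I r)" "r \<in> top_conv ?I (nbhds_in ?I r)" if "r \<in> ?I" for r
      using that by (auto simp: proper_on_def top_conv_def nbhds_in_neq_bot)
    have "H s \<in> continuous_conv ?I (top_conv ?I) X L (filtermap H (nbhds_in ?I s))"
      using H p[OF st(1)] st(1) by (auto simp: conv_continuous_def)
    then have "H s t \<in> L (filtermap (\<lambda>(g, z). g z) (filtermap H (nbhds_in ?I s) \<times>\<^sub>F nbhds_in ?I t))"
      using p[OF st(2)] st(2) by (auto simp: continuous_conv_def)
    also have "filtermap (\<lambda>(g, z). g z) (filtermap H (nbhds_in ?I s) \<times>\<^sub>F nbhds_in ?I t) =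
        filtermap h (nbhds_in unit_square (s, t))"
      unfolding nbhds_in_Times prod_filtermap1 filtermap_filtermap
      by (simp add: h_def apfst_def map_prod_def case_prod_unfold)
    finally show ?thesis by (simp add: h_def)
  qed
  then have "?Q h"
    using hX H01 Hp unfolding lim_continuous_on_def by (simp add: h_def conv_paths_def)
  then show "?P \<and> ?P' \<and> (\<exists>h. ?Q h)" using R by (auto simp: rel_homotopic_def)
next
  let ?I = "{0..1::real}"
  assume PQ: "?P \<and> ?P' \<and> (\<exists>h. ?Q h)"
  then have "\<exists>h. ?Q h" by (elim conjE)
  then obtain h where h: "?Q h" ..
  \<comment> \<open>points of the function space are extensional, so the curried map has to be restricted\<close>
  define H where "H = (\<lambda>s. \<lambda>t\<in>?I. h (s, t))"
  have Hp: "H s \<in> conv_paths X L x y" if "s \<in> ?I" for s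
  proof -
    have "lim_continuous_on ?I X L (\<lambda>t. h (s, t))"
      using that by (intro lim_continuous_on_compose[OF lim conjunct1[OF h]])
        (auto intro!: continuous_intros)
    then have "lim_continuous_on ?I X L (H s)"
      by (rule lim_continuous_on_cong) (simp add: H_def)
    then show ?thesis using h that by (simp add: conv_paths_iff[OF lim] H_def)
  qed
  have H01: "H 0 = \<gamma>" "H 1 = \<gamma>'"
    using PQ h by (auto simp: H_def conv_paths_iff[OF lim] fun_eq_iff extensional_def)
  have "conv_continuous ?I (top_conv ?I) (cont_maps ?I (top_conv ?I) X L)
          (continuous_conv ?I (top_conv ?I) X L) H"
    unfolding conv_continuous_def
  proof (intro conjI allI impI)
    show "H \<in> ?I \<rightarrow> cont_maps ?I (top_conv ?I) X L"
      using Hp by (auto simp: conv_paths_def)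
    fix F s assume F: "proper_on ?I F \<and> s \<in> ?I \<and> s \<in> top_conv ?I F"
    have "H s y \<in> L (filtermap (\<lambda>(g, z). g z) (filtermap H F \<times>\<^sub>F G))"
      if G: "proper_on ?I G" "y \<in> ?I" "y \<in> top_conv ?I G" for G y
    proof -
      have le: "F \<times>\<^sub>F G \<le> nbhds_in unit_square (s, y)"
        unfolding nbhds_in_Times using F G
        by (intro prod_filter_mono) (auto simp: proper_on_def top_conv_def)
      have "h (s, y) \<in> L (filtermap h (F \<times>\<^sub>F G))"
        using F G h by (intro lim_continuous_onD[OF lim _ _ le])
          (auto simp: proper_on_def prod_filter_eq_bot)
      also have "filtermap h (F \<times>\<^sub>F G) = filtermap (\<lambda>(s, t). H s t) (F \<times>\<^sub>F G)"
        by (rule filtermap_nbhds_in_cong[of unit_square]) (use le in \<open>auto simp: H_def\<close>)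
      also have "\<dots> = filtermap (\<lambda>(g, z). g z) (filtermap H F \<times>\<^sub>F G)"
        unfolding prod_filtermap1 filtermap_filtermap
        by (simp add: apfst_def map_prod_def case_prod_unfold)
      finally show ?thesis using G by (simp add: H_def)
    qed
    then show "H s \<in> continuous_conv ?I (top_conv ?I) X L (filtermap H F)"
      using F Hp by (auto simp: continuous_conv_def conv_paths_def)
  qed
  then show ?R
    unfolding rel_homotopic_def using PQ Hp H01 by blast
qed

section \<open>Paths and segments\<close>

definition lim_paths :: "'a set \<Rightarrow> ('a filter \<Rightarrow> 'a set) \<Rightarrow> (real \<Rightarrow> 'a) set" where
  "lim_paths X L = {\<gamma> \<in> extensional {0..1}. lim_continuous_on {0..1} X L \<gamma>}"

text \<open>
  An arrow of the fundamental groupoid determines the endpoints of its representatives, so that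
  they need not be given separately.
\<close>

definition path_arrow :: "'a set \<Rightarrow> ('a filter \<Rightarrow> 'a set) \<Rightarrow> (real \<Rightarrow> 'a) \<Rightarrow> 'a pi_arrow" where
  "path_arrow X L \<gamma> = (\<gamma> 0, hclass X L (\<gamma> 0) (\<gamma> 1) \<gamma>, \<gamma> 1)"

text \<open>
  Paths are obtained by restricting a map on a larger space, such as a path or a homotopy, to
  straight segments of its domain.
\<close>

definition segment :: "('b::real_normed_vector \<Rightarrow> 'a) \<Rightarrow> 'b \<Rightarrow> 'b \<Rightarrow> real \<Rightarrow> 'a" where
  "segment f p q = (\<lambda>t\<in>{0..1}. f (linepath p q t))"

lemma segment_0 [simp]: "segment f p q 0 = f p"
  and segment_1 [simp]: "segment f p q 1 = f q"
  by (simp_all add: segment_def linepath_def)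

lemma conv_paths_eq:
  assumes "limit_space X L"
  shows "conv_paths X L x y = {\<gamma> \<in> lim_paths X L. \<gamma> 0 = x \<and> \<gamma> 1 = y}"
  using conv_paths_iff[OF assms] by (auto simp: lim_paths_def)

lemma lim_paths_mem:
  assumes "\<gamma> \<in> lim_paths X L" "0 \<le> t" "t \<le> 1"
  shows "\<gamma> t \<in> X"
  using assms by (auto simp: lim_paths_def lim_continuous_on_def)

lemma lim_paths_subspace_iff:
  assumes "U \<subseteq> X"
  shows "\<gamma> \<in> lim_paths U (subspace_conv L U) \<longleftrightarrow> \<gamma> \<in> lim_paths X L \<and> \<gamma> ` {0..1} \<subseteq> U"
  using assms by (auto simp: lim_paths_def lim_continuous_on_subspace_iff)

lemma linepath_mem_convex:
  assumes "convex S" "p \<in> S" "q \<in> S" "0 \<le> t" "t \<le> 1"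
  shows "linepath p q t \<in> S"
  using assms by (auto simp: linepath_def convex_alt)

lemma segment_image_subset:
  assumes "convex S" "p \<in> S" "q \<in> S" "f ` S \<subseteq> U"
  shows "segment f p q ` {0..1} \<subseteq> U"
  using assms linepath_mem_convex[OF assms(1-3)] by (auto simp: segment_def)

lemma segment_in_lim_paths:
  fixes S :: "'b::real_normed_vector set"
  assumes "limit_space X L" "lim_continuous_on S X L f" "convex S" "p \<in> S" "q \<in> S"
  shows "segment f p q \<in> lim_paths X L"
proof -
  have "lim_continuous_on {0..1} X L (\<lambda>t. f (linepath p q t))"
    by (rule lim_continuous_on_compose[OF assms(1,2)])
       (use assms linepath_mem_convex in \<open>auto intro: continuous_on_linepath\<close>)
  then have "lim_continuous_on {0..1} X L (segment f p q)"
    by (rule lim_continuous_on_cong) (simp add: segment_def)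
  then show ?thesis by (simp add: lim_paths_def segment_def)
qed

lemma const_in_lim_paths:
  assumes "limit_space X L" "x \<in> X"
  shows "(\<lambda>t\<in>{0..1}. x) \<in> lim_paths X L"
proof -
  have "lim_continuous_on {0..1} X L (\<lambda>t\<in>{0..1}. x)"
    by (rule lim_continuous_on_cong[OF lim_continuous_on_const[OF assms]]) simp
  then show ?thesis by (simp add: lim_paths_def)
qed

lemma compose_ident_lim_path:
  assumes "\<gamma> \<in> lim_paths X L"
  shows "compose {0..1} (\<lambda>x. x) \<gamma> = \<gamma>"
  using assms by (auto simp: lim_paths_def compose_def fun_eq_iff extensional_def)

lemma segment_0_1:
  assumes "\<gamma> \<in> lim_paths X L"
  shows "segment \<gamma> 0 1 = \<gamma>"
  using assms by (auto simp: segment_def linepath_def lim_paths_def fun_eq_iff extensional_def)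

lemma conv_join_in_lim_paths:
  assumes lim: "limit_space X L" and "\<gamma> \<in> lim_paths X L" "\<rho> \<in> lim_paths X L" "\<gamma> 1 = \<rho> 0"
  shows "conv_join \<gamma> \<rho> \<in> lim_paths X L"
proof -
  have g: "lim_continuous_on {0..1} X L \<gamma>" and r: "lim_continuous_on {0..1} X L \<rho>"
    using assms(2,3) by (simp_all add: lim_paths_def)
  have "lim_continuous_on {0..1} X L (\<lambda>t. if t \<le> 1/2 then \<gamma> (2 * t) else \<rho> (2 * t - 1))"
  proof (rule lim_continuous_on_cases[OF lim])
    show "lim_continuous_on {t \<in> {0..1}. t \<le> 1/2} X L (\<lambda>t. \<gamma> (2 * t))"
      by (rule lim_continuous_on_compose[OF lim g]) (auto intro!: continuous_intros)
    show "lim_continuous_on {t \<in> {0..1}. 1/2 \<le> t} X L (\<lambda>t. \<rho> (2 * t - 1))"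
      by (rule lim_continuous_on_compose[OF lim r]) (auto intro!: continuous_intros)
    show "\<gamma> (2 * t) = \<rho> (2 * t - 1)" if "t = 1/2" for t
    proof -
      have "2 * t = 1" using that by simp
      then show ?thesis using assms(4) by (simp only:) simp
    qed
  qed auto
  then have "lim_continuous_on {0..1} X L (conv_join \<gamma> \<rho>)"
    by (rule lim_continuous_on_cong) (simp add: conv_join_def)
  then show ?thesis by (simp add: lim_paths_def conv_join_def)
qed

lemma conv_join_0 [simp]: "conv_join \<gamma> \<rho> 0 = \<gamma> 0"
  and conv_join_1 [simp]: "conv_join \<gamma> \<rho> 1 = \<rho> 1"
  by (simp_all add: conv_join_def)

section \<open>The calculus of homotopies\<close>

lemma rel_homotopic_refl:
  assumes lim: "limit_space X L" and "\<gamma> \<in> conv_paths X L x y"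
  shows "rel_homotopic X L x y \<gamma> \<gamma>"
proof -
  have "lim_continuous_on {0..1} X L \<gamma>" using assms by (simp add: conv_paths_iff)
  then have "lim_continuous_on unit_square X L (\<lambda>p. \<gamma> (snd p))"
    by (rule lim_continuous_on_compose[OF lim]) (auto intro!: continuous_intros)
  then show ?thesis
    using assms by (auto simp: rel_homotopic_iff conv_paths_iff intro!: exI[of _ "\<lambda>p. \<gamma> (snd p)"])
qed

lemma rel_homotopic_sym:
  assumes lim: "limit_space X L" and hom: "rel_homotopic X L x y \<gamma> \<rho>"
  shows "rel_homotopic X L x y \<rho> \<gamma>"
proof -
  obtain h where h: "lim_continuous_on unit_square X L h"
    "\<forall>t\<in>{0..1}. h (0, t) = \<gamma> t \<and> h (1, t) = \<rho> t \<and> h (t, 0) = x \<and> h (t, 1) = y"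
    using hom by (auto simp: rel_homotopic_iff[OF lim])
  have "lim_continuous_on unit_square X L (\<lambda>p. h (1 - fst p, snd p))"
    by (rule lim_continuous_on_compose[OF lim h(1)]) (auto intro!: continuous_intros)
  then show ?thesis
    using h(2) hom unfolding rel_homotopic_iff[OF lim]
    by (intro conjI exI[of _ "\<lambda>p. h (1 - fst p, snd p)"]) auto
qed

lemma rel_homotopic_trans:
  assumes lim: "limit_space X L"
    and hom: "rel_homotopic X L x y \<gamma> \<rho>" "rel_homotopic X L x y \<rho> \<sigma>"
  shows "rel_homotopic X L x y \<gamma> \<sigma>"
proof -
  obtain h where h: "lim_continuous_on unit_square X L h"
    "\<forall>t\<in>{0..1}. h (0, t) = \<gamma> t \<and> h (1, t) = \<rho> t \<and> h (t, 0) = x \<and> h (t, 1) = y"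
    using hom(1) by (auto simp: rel_homotopic_iff[OF lim])
  obtain k where k: "lim_continuous_on unit_square X L k"
    "\<forall>t\<in>{0..1}. k (0, t) = \<rho> t \<and> k (1, t) = \<sigma> t \<and> k (t, 0) = x \<and> k (t, 1) = y"
    using hom(2) by (auto simp: rel_homotopic_iff[OF lim])
  define m where "m = (\<lambda>p. if fst p \<le> 1/2 then h (2 * fst p, snd p) else k (2 * fst p - 1, snd p))"
  have "lim_continuous_on unit_square X L m"
    unfolding m_def
  proof (rule lim_continuous_on_cases[OF lim])
    show "lim_continuous_on {p \<in> unit_square. fst p \<le> 1/2} X L (\<lambda>p. h (2 * fst p, snd p))"
      by (rule lim_continuous_on_compose[OF lim h(1)]) (auto intro!: continuous_intros)
    show "lim_continuous_on {p \<in> unit_square. 1/2 \<le> fst p} X L (\<lambda>p. k (2 * fst p - 1, snd p))"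
      by (rule lim_continuous_on_compose[OF lim k(1)]) (auto intro!: continuous_intros)
    show "h (2 * fst p, snd p) = k (2 * fst p - 1, snd p)"
      if "p \<in> unit_square" "fst p = 1/2" for p
    proof -
      have "2 * fst p = 1" using that by simp
      then show ?thesis using that(1) h(2) k(2) by (simp only: mem_Times_iff) simp
    qed
  qed (auto intro!: continuous_intros closed_Times)
  moreover have "\<forall>t\<in>{0..1}. m (0, t) = \<gamma> t \<and> m (1, t) = \<sigma> t \<and> m (t, 0) = x \<and> m (t, 1) = y"
    using h(2) k(2) by (auto simp: m_def)
  ultimately show ?thesis
    using hom unfolding rel_homotopic_iff[OF lim] by blast
qed

lemma rel_homotopic_join:
  assumes lim: "limit_space X L"
    and hom: "rel_homotopic X L x y \<gamma> \<gamma>'" "rel_homotopic X L y z \<rho> \<rho>'"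
  shows "rel_homotopic X L x z (conv_join \<gamma> \<rho>) (conv_join \<gamma>' \<rho>')"
proof -
  obtain h where h: "lim_continuous_on unit_square X L h"
    "\<forall>t\<in>{0..1}. h (0, t) = \<gamma> t \<and> h (1, t) = \<gamma>' t \<and> h (t, 0) = x \<and> h (t, 1) = y"
    using hom(1) by (auto simp: rel_homotopic_iff[OF lim])
  obtain k where k: "lim_continuous_on unit_square X L k"
    "\<forall>t\<in>{0..1}. k (0, t) = \<rho> t \<and> k (1, t) = \<rho>' t \<and> k (t, 0) = y \<and> k (t, 1) = z"
    using hom(2) by (auto simp: rel_homotopic_iff[OF lim])
  define m where "m = (\<lambda>p. if snd p \<le> 1/2 then h (fst p, 2 * snd p) else k (fst p, 2 * snd p - 1))"
  have "lim_continuous_on unit_square X L m"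
    unfolding m_def
  proof (rule lim_continuous_on_cases[OF lim])
    show "lim_continuous_on {p \<in> unit_square. snd p \<le> 1/2} X L (\<lambda>p. h (fst p, 2 * snd p))"
      by (rule lim_continuous_on_compose[OF lim h(1)]) (auto intro!: continuous_intros)
    show "lim_continuous_on {p \<in> unit_square. 1/2 \<le> snd p} X L (\<lambda>p. k (fst p, 2 * snd p - 1))"
      by (rule lim_continuous_on_compose[OF lim k(1)]) (auto intro!: continuous_intros)
    show "h (fst p, 2 * snd p) = k (fst p, 2 * snd p - 1)"
      if "p \<in> unit_square" "snd p = 1/2" for p
    proof -
      have "2 * snd p = 1" using that by simp
      then show ?thesis using that(1) h(2) k(2) by (simp only: mem_Times_iff) simp
    qed
  qed (auto intro!: continuous_intros closed_Times)
  moreover have "\<forall>t\<in>{0..1}. m (0, t) = conv_join \<gamma> \<rho> t \<and> m (1, t) = conv_join \<gamma>' \<rho>' t \<and>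
      m (t, 0) = x \<and> m (t, 1) = z"
    using h(2) k(2) by (auto simp: m_def conv_join_def)
  moreover have "conv_join \<gamma> \<rho> \<in> conv_paths X L x z" "conv_join \<gamma>' \<rho>' \<in> conv_paths X L x z"
    using hom by (auto simp: rel_homotopic_def conv_paths_eq[OF lim] conv_join_in_lim_paths[OF lim])
  ultimately show ?thesis
    unfolding rel_homotopic_iff[OF lim] by blast
qed

text \<open>
  The broken line \<open>p q r\<close> and the segment \<open>p r\<close> are joined by the straight-line homotopy inside the
  convex set; composing it with \<open>f\<close> gives the homotopy in the limit space.
\<close>

lemma rel_homotopic_segments:
  fixes S :: "'b::real_normed_vector set"
  assumes lim: "limit_space X L" and f: "lim_continuous_on S X L f" and S: "convex S"
    and pqr: "p \<in> S" "q \<in> S" "r \<in> S"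
  shows "rel_homotopic X L (f p) (f r) (conv_join (segment f p q) (segment f q r)) (segment f p r)"
proof -
  define c where "c = linepath p q +++ linepath q r"
  have c: "continuous_on {0..1} c" 
    unfolding c_def by (intro continuous_on_joinpaths continuous_on_linepath)
      simp_all
  have cS: "c t \<in> S" if "t \<in> {0..1}" for t
    using that pqr linepath_mem_convex[OF S] by (simp add: c_def joinpaths_def)
  define h where "h = (\<lambda>u. f (linepath (c (snd u)) (linepath p r (snd u)) (fst u)))"
  have "lim_continuous_on unit_square X L h"
    unfolding h_def
  proof (rule lim_continuous_on_compose[OF lim f])
    have "continuous_on unit_square (\<lambda>u. c (snd u))"
      by (rule continuous_on_compose2[OF c]) (auto intro!: continuous_intros)
    then show "continuous_on unit_square (\<lambda>u. linepath (c (snd u)) (linepath p r (snd u)) (fst u))"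
      unfolding linepath_def by (intro continuous_intros)
    show "(\<lambda>u. linepath (c (snd u)) (linepath p r (snd u)) (fst u)) \<in> unit_square \<rightarrow> S"
      using cS pqr S by (auto intro!: linepath_mem_convex)
  qed
  moreover have "\<forall>t\<in>{0..1}. h (0, t) = conv_join (segment f p q) (segment f q r) t \<and>
      h (1, t) = segment f p r t \<and> h (t, 0) = f p \<and> h (t, 1) = f r"
  proof (intro ballI conjI)
    fix t :: real assume t: "t \<in> {0..1}"
    show "h (0, t) = conv_join (segment f p q) (segment f q r) t"
      using t by (simp add: h_def c_def joinpaths_def conv_join_def segment_def linepath_0')
    show "h (1, t) = segment f p r t"
      using t by (simp add: h_def segment_def linepath_1')
    show "h (t, 0) = f p"
      by (simp add: h_def c_def joinpaths_def linepath_0' linepath_refl)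
    show "h (t, 1) = f r"
      by (simp add: h_def c_def joinpaths_def linepath_1' linepath_refl)
  qed
  moreover have "conv_join (segment f p q) (segment f q r) \<in> conv_paths X L (f p) (f r)"
    "segment f p r \<in> conv_paths X L (f p) (f r)"
    using segment_in_lim_paths[OF lim f S] pqr
    by (auto simp: conv_paths_eq[OF lim] intro!: conv_join_in_lim_paths[OF lim])
  ultimately show ?thesis
    unfolding rel_homotopic_iff[OF lim] by blast
qed

section \<open>The fundamental groupoid\<close>

lemma hclass_eq_iff:
  assumes lim: "limit_space X L" and "\<gamma> \<in> conv_paths X L x y" 
  shows "hclass X L x y \<gamma> = hclass X L x y \<rho> \<longleftrightarrow> rel_homotopic X L x y \<gamma> \<rho>"
proof
  assume "hclass X L x y \<gamma> = hclass X L x y \<rho>"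
  moreover have "\<gamma> \<in> hclass X L x y \<gamma>"
    using rel_homotopic_refl[OF lim assms(2)] by (simp add: hclass_def)
  ultimately have "rel_homotopic X L x y \<rho> \<gamma>" by (simp add: hclass_def)
  then show "rel_homotopic X L x y \<gamma> \<rho>" by (rule rel_homotopic_sym[OF lim])
next
  assume "rel_homotopic X L x y \<gamma> \<rho>"
  then show "hclass X L x y \<gamma> = hclass X L x y \<rho>"
    using rel_homotopic_sym[OF lim] rel_homotopic_trans[OF lim] unfolding hclass_def by blast
qed

lemma path_arrow_eq_iff:
  assumes lim: "limit_space X L" and "\<gamma> \<in> lim_paths X L"
  shows "path_arrow X L \<gamma> = path_arrow X L \<rho> \<longleftrightarrow> rel_homotopic X L (\<gamma> 0) (\<gamma> 1) \<gamma> \<rho>"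
proof -
  have "\<gamma> \<in> conv_paths X L (\<gamma> 0) (\<gamma> 1)" using assms by (simp add: conv_paths_eq)
  note hclass_eq_iff[OF lim this, of \<rho>]
  moreover have "\<rho> 0 = \<gamma> 0 \<and> \<rho> 1 = \<gamma> 1" if "rel_homotopic X L (\<gamma> 0) (\<gamma> 1) \<gamma> \<rho>"
    using that by (simp add: rel_homotopic_def conv_paths_def)
  ultimately show ?thesis
    unfolding path_arrow_def by (metis prod.inject)
qed

text \<open>
  Operations on classes are written as unions over all representatives; the union is evaluated at
  one of them.
\<close>

lemma UN_hclass_eq:
  assumes lim: "limit_space X L" and "\<gamma> \<in> conv_paths X L x y"
    and "\<And>\<gamma>'. rel_homotopic X L x y \<gamma> \<gamma>' \<Longrightarrow> C \<gamma>' = C \<gamma>"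
  shows "(\<Union>\<gamma>'\<in>hclass X L x y \<gamma>. C \<gamma>') = C \<gamma>"
  using assms(3) rel_homotopic_refl[OF assms(1,2)] unfolding hclass_def by blast

lemma Arr_fundamental_groupoid:
  assumes "limit_space X L"
  shows "Arr (fundamental_groupoid X L) = path_arrow X L ` lim_paths X L"
proof -
  have "\<gamma> 0 \<in> X" "\<gamma> 1 \<in> X" if "\<gamma> \<in> lim_paths X L" for \<gamma>
    using lim_paths_mem[OF that] by auto
  then show ?thesis
    by (auto simp: fundamental_groupoid_def path_arrow_def conv_paths_eq[OF assms])
qed

lemma Obj_fundamental_groupoid [simp]: "Obj (fundamental_groupoid X L) = X"
  by (simp add: fundamental_groupoid_def)

lemma Dom_path_arrow [simp]: "Dom (fundamental_groupoid X L) (path_arrow X L \<gamma>) = \<gamma> 0"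
  and Cod_path_arrow [simp]: "Cod (fundamental_groupoid X L) (path_arrow X L \<gamma>) = \<gamma> 1"
  by (simp_all add: fundamental_groupoid_def path_arrow_def)

lemma Id_fundamental_groupoid:
  "Id (fundamental_groupoid X L) x = path_arrow X L (\<lambda>t\<in>{0..1}. x)"
  by (simp add: fundamental_groupoid_def path_arrow_def)

lemma Comp_path_arrow:
  assumes lim: "limit_space X L" and \<gamma>: "\<gamma> \<in> lim_paths X L" and \<rho>: "\<rho> \<in> lim_paths X L"
    and eq: "\<gamma> 1 = \<rho> 0"
  shows "Comp (fundamental_groupoid X L) (path_arrow X L \<rho>) (path_arrow X L \<gamma>) =
    path_arrow X L (conv_join \<gamma> \<rho>)"
proof -
  have cp: "\<gamma> \<in> conv_paths X L (\<gamma> 0) (\<gamma> 1)" "\<rho> \<in> conv_paths X L (\<rho> 0) (\<rho> 1)"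
    using \<gamma> \<rho> by (auto simp: conv_paths_eq[OF lim])
  have class_join: "hclass X L (\<gamma> 0) (\<rho> 1) (conv_join \<gamma>' \<rho>') = hclass X L (\<gamma> 0) (\<rho> 1) (conv_join \<gamma> \<rho>)"
    if "rel_homotopic X L (\<gamma> 0) (\<gamma> 1) \<gamma> \<gamma>'" "rel_homotopic X L (\<rho> 0) (\<rho> 1) \<rho> \<rho>'" for \<gamma>' \<rho>'
    using rel_homotopic_join[OF lim that(1)] that(2) eq hclass_eq_iff[OF lim]
    by (metis rel_homotopic_def)
  have "(\<Union>\<gamma>'\<in>hclass X L (\<gamma> 0) (\<gamma> 1) \<gamma>. \<Union>\<rho>'\<in>hclass X L (\<rho> 0) (\<rho> 1) \<rho>.
      hclass X L (\<gamma> 0) (\<rho> 1) (conv_join \<gamma>' \<rho>')) = hclass X L (\<gamma> 0) (\<rho> 1) (conv_join \<gamma> \<rho>)"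
    using class_join rel_homotopic_refl[OF lim cp(1)] rel_homotopic_refl[OF lim cp(2)]
    unfolding hclass_def[of X L "\<gamma> 0" "\<gamma> 1"] hclass_def[of X L "\<rho> 0" "\<rho> 1"] by blast
  then show ?thesis
    by (simp add: fundamental_groupoid_def path_arrow_def)
qed

text \<open>
  Reparametrisation, subdivision and the squares of a homotopy are all instances of this triangle
  identity, for different maps \<open>f\<close> and points of their domains.
\<close>

lemma Comp_segments:
  fixes S :: "'b::real_normed_vector set"
  assumes lim: "limit_space X L" and f: "lim_continuous_on S X L f" and S: "convex S"
    and pqr: "p \<in> S" "q \<in> S" "r \<in> S"
  shows "Comp (fundamental_groupoid X L) (path_arrow X L (segment f q r)) (path_arrow X L (segment f p q)) =
    path_arrow X L (segment f p r)"
proof -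
  note seg = segment_in_lim_paths[OF lim f S]
  have "path_arrow X L (conv_join (segment f p q) (segment f q r)) = path_arrow X L (segment f p r)"
    using rel_homotopic_segments[OF lim f S pqr] pqr seg
    by (subst path_arrow_eq_iff[OF lim]) (auto intro!: conv_join_in_lim_paths[OF lim])
  then show ?thesis
    using Comp_path_arrow[OF lim] seg pqr by simp
qed

lemma Id_eq_path_arrow_segment: "Id (fundamental_groupoid X L) (f p) = path_arrow X L (segment f p p)"
  by (simp add: Id_fundamental_groupoid segment_def linepath_refl)

text \<open>
  Each law is the triangle identity for one path \<open>f\<close> and points of \<open>[0,1]\<close>: the units use the
  degenerate triangles \<open>0 0 1\<close> and \<open>0 1 1\<close>, the inverses use \<open>0 1 0\<close> and \<open>1 0 1\<close>, and associativity
  uses the points \<open>0, 1/4, 1/2, 1\<close> of the concatenation of the three paths.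
\<close>

lemma is_groupoid_fundamental_groupoid:
  assumes lim: "limit_space X L"
  shows "is_groupoid (fundamental_groupoid X L)" (is "is_groupoid ?G")
proof -
  note Arr = Arr_fundamental_groupoid[OF lim]
  have path: "lim_continuous_on {0..1} X L \<gamma>" if "\<gamma> \<in> lim_paths X L" for \<gamma>
    using that by (simp add: lim_paths_def)
  note seg = segment_in_lim_paths[OF lim path, of _ "_ :: real"]
  note comp_seg = Comp_segments[OF lim path, of _ "_ :: real"]
  note const = const_in_lim_paths[OF lim]
  have unit: "Comp ?G (path_arrow X L \<gamma>) (Id ?G (\<gamma> 0)) = path_arrow X L \<gamma>"
    "Comp ?G (Id ?G (\<gamma> 1)) (path_arrow X L \<gamma>) = path_arrow X L \<gamma>" if "\<gamma> \<in> lim_paths X L" for \<gamma>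
    unfolding Id_eq_path_arrow_segment
    using comp_seg[OF that, of 0 0 1] comp_seg[OF that, of 0 1 1] segment_0_1[OF that] by simp_all
  have assoc: "Comp ?G (path_arrow X L \<sigma>) (Comp ?G (path_arrow X L \<rho>) (path_arrow X L \<gamma>)) =
      Comp ?G (Comp ?G (path_arrow X L \<sigma>) (path_arrow X L \<rho>)) (path_arrow X L \<gamma>)"
    if p: "\<gamma> \<in> lim_paths X L" "\<rho> \<in> lim_paths X L" "\<sigma> \<in> lim_paths X L"
      and e: "\<gamma> 1 = \<rho> 0" "\<rho> 1 = \<sigma> 0" for \<gamma> \<rho> \<sigma>
  proof -
    define f where "f = conv_join (conv_join \<gamma> \<rho>) \<sigma>"
    have f: "f \<in> lim_paths X L"
      unfolding f_def using p e by (intro conv_join_in_lim_paths[OF lim]) auto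
    have ext: "\<gamma> \<in> extensional {0..1}" "\<rho> \<in> extensional {0..1}" "\<sigma> \<in> extensional {0..1}"
      using p by (auto simp: lim_paths_def)
    have "\<gamma> = segment f 0 (1/4)"
      using ext(1) by (auto simp: fun_eq_iff f_def segment_def linepath_def conv_join_def extensional_def)
    moreover have "\<rho> = segment f (1/4) (1/2)"
    proof
      fix t
      show "\<rho> t = segment f (1/4) (1/2) t"
      proof (cases "t = 0 \<or> t \<notin> {0..1}")
        case True
        then show ?thesis
          using ext(2) e(1)
          by (auto simp: f_def segment_def linepath_def conv_join_def extensional_def)
      next
        case False
        then show ?thesis
          by (auto simp: f_def segment_def linepath_def conv_join_def field_simps)
      qed
    qed
    moreover have "\<sigma> = segment f (1/2) 1"
    proof
      fix t
      show "\<sigma> t = segment f (1/2) 1 t"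
      proof (cases "t = 0 \<or> t \<notin> {0..1}")
        case True
        then show ?thesis
          using ext(3) e(2)
          by (auto simp: f_def segment_def linepath_def conv_join_def extensional_def)
      next
        case False
        then show ?thesis
          by (auto simp: f_def segment_def linepath_def conv_join_def field_simps)
      qed
    qed
    ultimately show ?thesis
      using comp_seg[OF f, of 0 "1/4" "1/2"] comp_seg[OF f, of 0 "1/2" 1]
        comp_seg[OF f, of "1/4" "1/2" 1] comp_seg[OF f, of 0 "1/4" 1] by simp
  qed
  have inverse: "\<exists>\<rho>\<in>lim_paths X L. \<rho> 0 = \<gamma> 1 \<and> \<rho> 1 = \<gamma> 0 \<and>
      Comp ?G (path_arrow X L \<rho>) (path_arrow X L \<gamma>) = Id ?G (\<gamma> 0) \<and>
      Comp ?G (path_arrow X L \<gamma>) (path_arrow X L \<rho>) = Id ?G (\<gamma> 1)" if "\<gamma> \<in> lim_paths X L" for \<gamma>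
    unfolding Id_eq_path_arrow_segment
    using comp_seg[OF that, of 0 1 0] comp_seg[OF that, of 1 0 1] segment_0_1[OF that]
      seg[OF that, of 1 0]
    by (intro bexI[of _ "segment \<gamma> 1 0"]) simp_all
  have join: "Comp ?G (path_arrow X L \<rho>) (path_arrow X L \<gamma>) \<in> Arr ?G \<and>
      Dom ?G (Comp ?G (path_arrow X L \<rho>) (path_arrow X L \<gamma>)) = \<gamma> 0 \<and>
      Cod ?G (Comp ?G (path_arrow X L \<rho>) (path_arrow X L \<gamma>)) = \<rho> 1"
    if "\<gamma> \<in> lim_paths X L" "\<rho> \<in> lim_paths X L" "\<gamma> 1 = \<rho> 0" for \<gamma> \<rho>
    using Comp_path_arrow[OF lim that] conv_join_in_lim_paths[OF lim that] by (simp add: Arr)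
  have "\<gamma> 0 \<in> X" "\<gamma> 1 \<in> X" if "\<gamma> \<in> lim_paths X L" for \<gamma>
    using lim_paths_mem[OF that] by auto
  then have "is_category ?G"
    unfolding is_category_def Arr ball_simps
    using const join[unfolded Arr] unit assoc
    by (auto simp: Id_fundamental_groupoid)
  then show ?thesis
    unfolding is_groupoid_def Arr using inverse by (fastforce simp: Arr)
qed

section \<open>Functoriality of the fundamental groupoid\<close>

lemma compose_in_lim_paths:
  assumes "limit_space X L" "conv_continuous X L Y M f" "\<gamma> \<in> lim_paths X L"
  shows "compose {0..1} f \<gamma> \<in> lim_paths Y M"
proof -
  have "lim_continuous_on {0..1} Y M (\<lambda>t. f (\<gamma> t))"
    using assms(3)
    by (intro lim_continuous_on_conv_continuous[OF assms(1) _ assms(2)]) (simp add: lim_paths_def)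
  then have "lim_continuous_on {0..1} Y M (compose {0..1} f \<gamma>)"
    by (rule lim_continuous_on_cong) (simp add: compose_def)
  then show ?thesis by (simp add: lim_paths_def)
qed

lemma rel_homotopic_compose:
  assumes X: "limit_space X L" and Y: "limit_space Y M" and f: "conv_continuous X L Y M f"
    and hom: "rel_homotopic X L x y \<gamma> \<rho>"
  shows "rel_homotopic Y M (f x) (f y) (compose {0..1} f \<gamma>) (compose {0..1} f \<rho>)"
proof -
  obtain h where h: "lim_continuous_on unit_square X L h"
    "\<forall>t\<in>{0..1}. h (0, t) = \<gamma> t \<and> h (1, t) = \<rho> t \<and> h (t, 0) = x \<and> h (t, 1) = y"
    using hom by (auto simp: rel_homotopic_iff[OF X])
  have "lim_continuous_on unit_square Y M (\<lambda>u. f (h u))"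
    by (rule lim_continuous_on_conv_continuous[OF X h(1) f])
  moreover have "compose {0..1} f \<gamma> \<in> conv_paths Y M (f x) (f y)"
    "compose {0..1} f \<rho> \<in> conv_paths Y M (f x) (f y)"
    using hom compose_in_lim_paths[OF X f]
    by (auto simp: rel_homotopic_def conv_paths_eq[OF X] conv_paths_eq[OF Y] compose_def)
  ultimately show ?thesis
    unfolding rel_homotopic_iff[OF Y] using h(2)
    by (intro conjI exI[of _ "\<lambda>u. f (h u)"]) (auto simp: compose_def)
qed

lemma on_arr_fundamental_functor:
  assumes X: "limit_space X L" and Y: "limit_space Y M" and f: "conv_continuous X L Y M f"
    and \<gamma>: "\<gamma> \<in> lim_paths X L"
  shows "on_arr (fundamental_functor X L Y M f) (path_arrow X L \<gamma>) =
    path_arrow Y M (compose {0..1} f \<gamma>)"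
proof -
  have cp: "\<gamma> \<in> conv_paths X L (\<gamma> 0) (\<gamma> 1)" using \<gamma> by (simp add: conv_paths_eq[OF X])
  have "(\<Union>\<gamma>'\<in>hclass X L (\<gamma> 0) (\<gamma> 1) \<gamma>. hclass Y M (f (\<gamma> 0)) (f (\<gamma> 1)) (compose {0..1} f \<gamma>')) =
      hclass Y M (f (\<gamma> 0)) (f (\<gamma> 1)) (compose {0..1} f \<gamma>)"
    using rel_homotopic_compose[OF X Y f] hclass_eq_iff[OF Y]
    by (intro UN_hclass_eq[OF X cp]) (metis rel_homotopic_def)
  moreover have "path_arrow X L \<gamma> \<in> Arr (fundamental_groupoid X L)"
    using \<gamma> by (simp add: Arr_fundamental_groupoid[OF X])
  ultimately show ?thesis
    by (simp add: fundamental_functor_def path_arrow_def compose_def)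
qed

lemma compose_conv_join: "compose {0..1} f (conv_join \<gamma> \<rho>) = conv_join (compose {0..1} f \<gamma>) (compose {0..1} f \<rho>)"
  by (auto simp: fun_eq_iff compose_def conv_join_def)

lemma is_functor_fundamental_functor:
  assumes X: "limit_space X L" and Y: "limit_space Y M" and f: "conv_continuous X L Y M f"
  shows "is_functor (fundamental_groupoid X L) (fundamental_groupoid Y M)
    (fundamental_functor X L Y M f)" (is "is_functor ?G ?H ?F")
proof -
  note ArrX = Arr_fundamental_groupoid[OF X] and ArrY = Arr_fundamental_groupoid[OF Y]
  note on_arr = on_arr_fundamental_functor[OF X Y f]
  note cp = compose_in_lim_paths[OF X f]
  note const = const_in_lim_paths[OF X]
  have obj: "on_obj ?F x = f x" if "x \<in> X" for x using that by (simp add: fundamental_functor_def)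
  have "on_obj ?F \<in> X \<rightarrow>\<^sub>E Y"
    using f by (auto simp: fundamental_functor_def conv_continuous_def)
  moreover have "on_arr ?F \<in> Arr ?G \<rightarrow>\<^sub>E Arr ?H"
  proof (rule PiE_I)
    show "on_arr ?F a \<in> Arr ?H" if "a \<in> Arr ?G" for a
      using that cp by (auto simp: ArrX ArrY on_arr)
    show "on_arr ?F a = undefined" if "a \<notin> Arr ?G" for a
      using that by (simp add: fundamental_functor_def)
  qed
  moreover have "Dom ?H (on_arr ?F a) = on_obj ?F (Dom ?G a) \<and> Cod ?H (on_arr ?F a) = on_obj ?F (Cod ?G a)"
    if "a \<in> Arr ?G" for a
    using that by (auto simp: ArrX on_arr obj lim_paths_mem compose_def)
  moreover have "on_arr ?F (Id ?G x) = Id ?H (on_obj ?F x)" if "x \<in> X" for x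
    using that by (auto simp: Id_fundamental_groupoid on_arr const obj compose_def intro!: arg_cong[of _ _ "path_arrow Y M"])
  moreover have "on_arr ?F (Comp ?G b a) = Comp ?H (on_arr ?F b) (on_arr ?F a)"
    if ab: "a \<in> Arr ?G" "b \<in> Arr ?G" "Cod ?G a = Dom ?G b" for a b
  proof -
    obtain \<gamma> \<rho> where "a = path_arrow X L \<gamma>" "b = path_arrow X L \<rho>"
      and gr: "\<gamma> \<in> lim_paths X L" "\<rho> \<in> lim_paths X L"
      using ab(1,2) by (auto simp: ArrX)
    moreover from this ab(3) have "\<gamma> 1 = \<rho> 0" by simp
    ultimately show ?thesis
      using Comp_path_arrow[OF X gr] Comp_path_arrow[OF Y cp[OF gr(1)] cp[OF gr(2)]]
        conv_join_in_lim_paths[OF X gr]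
      by (simp add: on_arr compose_conv_join) (simp add: compose_def)
  qed
  ultimately show ?thesis
    by (simp add: is_functor_def)
qed

lemma comp_fundamental_functor:
  assumes X: "limit_space X L" and Y: "limit_space Y M" and Z: "limit_space Z N"
    and f: "conv_continuous X L Y M f" and g: "conv_continuous Y M Z N g"
  shows "comp_functor (fundamental_groupoid X L) (fundamental_functor Y M Z N g)
      (fundamental_functor X L Y M f) = fundamental_functor X L Z N (\<lambda>x. g (f x))"
proof -
  note ArrX = Arr_fundamental_groupoid[OF X]
  note gf = conv_continuous_compose[OF f g]
  have comp_assoc: "compose {0..1} g (compose {0..1} f \<gamma>) = compose {0..1} (\<lambda>x. g (f x)) \<gamma>" for \<gamma> :: "real \<Rightarrow> _"
    by (auto simp: compose_def)
  have "on_arr (fundamental_functor Y M Z N g) (on_arr (fundamental_functor X L Y M f) a) =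
      on_arr (fundamental_functor X L Z N (\<lambda>x. g (f x))) a" if "a \<in> Arr (fundamental_groupoid X L)" for a
    using that compose_in_lim_paths[OF X f]
    by (auto simp: ArrX on_arr_fundamental_functor[OF X Y f] on_arr_fundamental_functor[OF Y Z g]
        on_arr_fundamental_functor[OF X Z gf] comp_assoc)
  moreover have "on_arr (fundamental_functor X L Z N (\<lambda>x. g (f x))) a = undefined"
    if "a \<notin> Arr (fundamental_groupoid X L)" for a
    using that by (simp add: fundamental_functor_def)
  ultimately have "compose (Arr (fundamental_groupoid X L)) (on_arr (fundamental_functor Y M Z N g))
      (on_arr (fundamental_functor X L Y M f)) = on_arr (fundamental_functor X L Z N (\<lambda>x. g (f x)))"
    by (intro ext) (simp add: compose_def restrict_def)
  moreover have "compose X (on_obj (fundamental_functor Y M Z N g)) (on_obj (fundamental_functor X L Y M f)) =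
      on_obj (fundamental_functor X L Z N (\<lambda>x. g (f x)))"
    using f by (auto simp: compose_def fun_eq_iff fundamental_functor_def conv_continuous_def)
  ultimately show ?thesis
    by (simp add: comp_functor_def)
qed

lemma fundamental_functor_id:
  assumes X: "limit_space X L"
  shows "fundamental_functor X L X L (\<lambda>x. x) = id_functor (fundamental_groupoid X L)"
proof -
  have "conv_continuous X L X L (\<lambda>x. x)" by (auto simp: conv_continuous_def filtermap_ident)
  then have "on_arr (fundamental_functor X L X L (\<lambda>x. x)) a = a"
    if "a \<in> Arr (fundamental_groupoid X L)" for a
    using that
    by (auto simp: Arr_fundamental_groupoid[OF X] on_arr_fundamental_functor[OF X X]
        compose_ident_lim_path)
  moreover have "on_arr (fundamental_functor X L X L (\<lambda>x. x)) a = undefined"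
    if "a \<notin> Arr (fundamental_groupoid X L)" for a
    using that by (simp add: fundamental_functor_def)
  ultimately have "on_arr (fundamental_functor X L X L (\<lambda>x. x)) = (\<lambda>a\<in>Arr (fundamental_groupoid X L). a)"
    by (intro ext) (simp add: restrict_def)
  then show ?thesis
    by (simp add: id_functor_def fundamental_functor_def)
qed

section \<open>Composites of chains of arrows\<close>

definition hom :: "('o, 'm) cat \<Rightarrow> 'o \<Rightarrow> 'o \<Rightarrow> 'm set" where
  "hom C x y = {f \<in> Arr C. Dom C f = x \<and> Cod C f = y}"

lemma Id_in_hom: "is_category C \<Longrightarrow> x \<in> Obj C \<Longrightarrow> Id C x \<in> hom C x x"
  and Comp_in_hom: "is_category C \<Longrightarrow> f \<in> hom C x y \<Longrightarrow> g \<in> hom C y z \<Longrightarrow> Comp C g f \<in> hom C x z"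
  and Comp_Id_right: "is_category C \<Longrightarrow> f \<in> hom C x y \<Longrightarrow> Comp C f (Id C x) = f"
  and Comp_Id_left: "is_category C \<Longrightarrow> f \<in> hom C x y \<Longrightarrow> Comp C (Id C y) f = f"
  and Comp_assoc: "is_category C \<Longrightarrow> f \<in> hom C x y \<Longrightarrow> g \<in> hom C y z \<Longrightarrow> h \<in> hom C z w \<Longrightarrow>
    Comp C h (Comp C g f) = Comp C (Comp C h g) f"
  unfolding is_category_def hom_def by auto

text \<open>
  The objects through which the chain passes are not recorded; the start \<open>x\<close> is needed for the
  empty chain.
\<close>

primrec chain_comp :: "('o, 'm) cat \<Rightarrow> 'o \<Rightarrow> (nat \<Rightarrow> 'm) \<Rightarrow> nat \<Rightarrow> 'm" where
  "chain_comp C x a 0 = Id C x"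
| "chain_comp C x a (Suc n) = Comp C (a n) (chain_comp C x a n)"

lemma chain_comp_cong:
  assumes "x = y" "n = m" "\<And>i. i < m \<Longrightarrow> a i = b i"
  shows "chain_comp C x a n = chain_comp C y b m"
  unfolding assms(1,2) using assms(3) by (induction m) auto

lemma chain_comp_in_hom:
  assumes "is_category C" "p 0 \<in> Obj C" "\<And>i. i < n \<Longrightarrow> a i \<in> hom C (p i) (p (Suc i))"
  shows "chain_comp C (p 0) a n \<in> hom C (p 0) (p n)"
  using assms(3) by (induction n) (auto intro: Id_in_hom Comp_in_hom assms(1,2))

lemma chain_comp_add:
  assumes C: "is_category C" and p: "\<And>i. p i \<in> Obj C"
    and a: "\<And>i. i < n + m \<Longrightarrow> a i \<in> hom C (p i) (p (Suc i))"
  shows "chain_comp C (p 0) a (n + m) =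
    Comp C (chain_comp C (p n) (\<lambda>j. a (n + j)) m) (chain_comp C (p 0) a n)"
  using a
proof (induction m)
  case 0
  then show ?case
    using Comp_Id_left[OF C chain_comp_in_hom[of C p n a, OF C p]] by simp
next
  case (Suc m)
  have head: "chain_comp C (p 0) a n \<in> hom C (p 0) (p n)"
    using Suc.prems by (intro chain_comp_in_hom[OF C p]) auto
  have rest: "chain_comp C (p n) (\<lambda>j. a (n + j)) m \<in> hom C (p n) (p (n + m))"
    using chain_comp_in_hom[OF C, of "\<lambda>j. p (n + j)" m "\<lambda>j. a (n + j)"] p Suc.prems by simp
  have last: "a (n + m) \<in> hom C (p (n + m)) (p (Suc (n + m)))"
    using Suc.prems by auto
  show ?case
    using Suc.IH Suc.prems Comp_assoc[OF C head rest last] by simp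
qed

lemma chain_comp_blocks:
  assumes C: "is_category C" and p: "\<And>i. p i \<in> Obj C"
    and a: "\<And>i. i < n * m \<Longrightarrow> a i \<in> hom C (p i) (p (Suc i))"
  shows "chain_comp C (p 0) a (n * m) =
    chain_comp C (p 0) (\<lambda>i. chain_comp C (p (i * m)) (\<lambda>j. a (i * m + j)) m) n"
  using a
proof (induction n)
  case (Suc n)
  have "chain_comp C (p 0) a (n * m + m) =
      Comp C (chain_comp C (p (n * m)) (\<lambda>j. a (n * m + j)) m) (chain_comp C (p 0) a (n * m))"
    using Suc.prems by (intro chain_comp_add[OF C p]) auto
  then show ?case
    using Suc by (simp add: add.commute)
qed simp

text \<open>
  The squares are pasted along their common vertical arrows.
\<close>

lemma chain_comp_squares:
  assumes C: "is_category C" and p: "p 0 \<in> Obj C" and q: "q 0 \<in> Obj C"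
    and a: "\<And>i. i < n \<Longrightarrow> a i \<in> hom C (p i) (p (Suc i))"
    and b: "\<And>i. i < n \<Longrightarrow> b i \<in> hom C (q i) (q (Suc i))"
    and v: "\<And>i. i \<le> n \<Longrightarrow> v i \<in> hom C (p i) (q i)"
    and sq: "\<And>i. i < n \<Longrightarrow> Comp C (b i) (v i) = Comp C (v (Suc i)) (a i)"
  shows "Comp C (chain_comp C (q 0) b n) (v 0) = Comp C (v n) (chain_comp C (p 0) a n)"
  using a b v sq
proof (induction n)
  case 0
  then show ?case using Comp_Id_left[OF C] Comp_Id_right[OF C] by fastforce
next
  case (Suc n)
  have A: "chain_comp C (p 0) a n \<in> hom C (p 0) (p n)"
    and B: "chain_comp C (q 0) b n \<in> hom C (q 0) (q n)"
    using Suc.prems p q by (auto intro!: chain_comp_in_hom[OF C])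
  have arrs: "a n \<in> hom C (p n) (p (Suc n))" "b n \<in> hom C (q n) (q (Suc n))"
    "v 0 \<in> hom C (p 0) (q 0)" "v n \<in> hom C (p n) (q n)" "v (Suc n) \<in> hom C (p (Suc n)) (q (Suc n))"
    using Suc.prems by auto
  have "Comp C (chain_comp C (q 0) b (Suc n)) (v 0) = Comp C (b n) (Comp C (chain_comp C (q 0) b n) (v 0))"
    using Comp_assoc[OF C arrs(3) B arrs(2)] by simp
  also have "\<dots> = Comp C (b n) (Comp C (v n) (chain_comp C (p 0) a n))"
    using Suc by simp
  also have "\<dots> = Comp C (Comp C (v (Suc n)) (a n)) (chain_comp C (p 0) a n)"
    using Comp_assoc[OF C A arrs(4,2)] Suc.prems(4)[of n] by simp
  also have "\<dots> = Comp C (v (Suc n)) (chain_comp C (p 0) a (Suc n))"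
    using Comp_assoc[OF C A arrs(1,5)] by simp
  finally show ?case .
qed

text \<open>
  For a family of arrows that satisfies the triangle identity, only the two ends of the chain
  matter.
\<close>

lemma chain_comp_telescope:
  assumes "b 0 0 = Id C x" "\<And>i. i < n \<Longrightarrow> Comp C (b i (Suc i)) (b 0 i) = b 0 (Suc i)"
  shows "chain_comp C x (\<lambda>i. b i (Suc i)) n = b 0 n"
  using assms(2) by (induction n) (auto simp: assms(1))

lemma functor_in_hom:
  assumes "is_functor C D T" "f \<in> hom C x y"
  shows "on_arr T f \<in> hom D (on_obj T x) (on_obj T y)"
  using assms by (auto simp: is_functor_def hom_def)

lemma functor_Comp:
  assumes "is_functor C D T" "f \<in> hom C x y" "g \<in> hom C y z"
  shows "on_arr T (Comp C g f) = Comp D (on_arr T g) (on_arr T f)"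
  using assms by (auto simp: is_functor_def hom_def)

lemma functor_chain_comp:
  assumes T: "is_functor C D T" and C: "is_category C" and p: "p 0 \<in> Obj C"
    and a: "\<And>i. i < n \<Longrightarrow> a i \<in> hom C (p i) (p (Suc i))"
  shows "on_arr T (chain_comp C (p 0) a n) = chain_comp D (on_obj T (p 0)) (\<lambda>i. on_arr T (a i)) n"
  using a
proof (induction n)
  case 0
  then show ?case using T p by (simp add: is_functor_def)
next
  case (Suc n)
  have "chain_comp C (p 0) a n \<in> hom C (p 0) (p n)" "a n \<in> hom C (p n) (p (Suc n))"
    using Suc.prems by (auto intro!: chain_comp_in_hom[OF C] p)
  from functor_Comp[OF T this] Suc show ?case by simp
qed

lemma functor_eqI:
  assumes "is_functor C D S" "on_obj T \<in> extensional (Obj C)" "on_arr T \<in> extensional (Arr C)"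
    and "\<And>x. x \<in> Obj C \<Longrightarrow> on_obj S x = on_obj T x" "\<And>f. f \<in> Arr C \<Longrightarrow> on_arr S f = on_arr T f"
  shows "S = T"
proof -
  have "on_obj S \<in> extensional (Obj C)" "on_arr S \<in> extensional (Arr C)"
    using assms(1) by (auto simp: is_functor_def PiE_def)
  then have "on_obj S = on_obj T" "on_arr S = on_arr T"
    using assms(2-5) by (auto intro: extensionalityI)
  then show ?thesis by (cases S; cases T) simp
qed

section \<open>Subdivision of paths\<close>

lemma segment_cong:
  assumes "\<And>t. 0 \<le> t \<Longrightarrow> t \<le> 1 \<Longrightarrow> f (linepath p q t) = g (linepath p' q' t)"
  shows "segment f p q = segment g p' q'"
  using assms by (auto simp: segment_def)

lemma linepath_bounds:
  fixes a b t :: real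
  assumes "a \<le> b" "0 \<le> t" "t \<le> 1"
  shows "a \<le> linepath a b t" "linepath a b t \<le> b"
proof -
  have "linepath a b t \<in> {a..b}"
    using assms by (intro linepath_mem_convex) auto
  then show "a \<le> linepath a b t" "linepath a b t \<le> b" by auto
qed

lemma segment_conv_join_left:
  assumes "0 \<le> a" "a \<le> b" "b \<le> 1/2"
  shows "segment (conv_join \<gamma> \<rho>) a b = segment \<gamma> (2 * a) (2 * b)"
proof (rule segment_cong)
  fix t :: real assume "0 \<le> t" "t \<le> 1"
  from linepath_bounds[OF assms(2) this] show "conv_join \<gamma> \<rho> (linepath a b t) = \<gamma> (linepath (2 * a) (2 * b) t)"
    using assms by (simp add: conv_join_def) (simp add: linepath_def algebra_simps)
qed

lemma segment_conv_join_right: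
  assumes "1/2 \<le> a" "a \<le> b" "b \<le> 1" "\<gamma> 1 = \<rho> 0"
  shows "segment (conv_join \<gamma> \<rho>) a b = segment \<rho> (2 * a - 1) (2 * b - 1)"
proof (rule segment_cong)
  fix t :: real assume t: "0 \<le> t" "t \<le> 1"
  let ?s = "linepath a b t"
  have "conv_join \<gamma> \<rho> ?s = \<rho> (2 * ?s - 1)"
  \<comment> \<open>at \<open>1/2\<close> the concatenation is defined by the first path\<close>
  proof (cases "?s = 1/2")
    case True
    then have "2 * ?s = 1" by simp
    then show ?thesis using assms(4) by (simp add: conv_join_def)
  next
    case False
    then show ?thesis using linepath_bounds[OF assms(2) t] assms by (simp add: conv_join_def)
  qed
  also have "2 * ?s - 1 = linepath (2 * a - 1) (2 * b - 1) t"
    by (simp add: linepath_def algebra_simps)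
  finally show "conv_join \<gamma> \<rho> ?s = \<rho> (linepath (2 * a - 1) (2 * b - 1) t)" .
qed

lemma path_arrow_segment_in_hom:
  fixes S :: "'b::real_normed_vector set"
  assumes "limit_space X L" "lim_continuous_on S X L f" "convex S" "p \<in> S" "q \<in> S"
  shows "path_arrow X L (segment f p q) \<in> hom (fundamental_groupoid X L) (f p) (f q)"
  using segment_in_lim_paths[OF assms] by (simp add: hom_def Arr_fundamental_groupoid[OF assms(1)])

lemma is_category_fundamental_groupoid:
  "limit_space X L \<Longrightarrow> is_category (fundamental_groupoid X L)"
  using is_groupoid_fundamental_groupoid by (auto simp: is_groupoid_def)

definition piece :: "(real \<Rightarrow> 'a) \<Rightarrow> nat \<Rightarrow> nat \<Rightarrow> real \<Rightarrow> 'a" where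
  "piece \<gamma> N i = segment \<gamma> (real i / real N) (real (Suc i) / real N)"

lemma grid_mem: "i \<le> N \<Longrightarrow> real i / real N \<in> {0..1}"
  by (auto simp: divide_le_eq_1)

lemma cell_bounds: "real i / real N \<le> real (Suc i) / real N"
  by (simp add: divide_right_mono)

lemma cell_subset: "i < N \<Longrightarrow> {real i / real N..real (Suc i) / real N} \<subseteq> {0..1}"
  using grid_mem[of "Suc i" N] by (simp add: atLeastatMost_subset_iff del: of_nat_Suc)

lemma piece_conv_join:
  assumes "0 < N" "\<gamma> 1 = \<rho> 0"
  shows "i < N \<Longrightarrow> piece (conv_join \<gamma> \<rho>) (N + N) i = piece \<gamma> N i"
    and "i < N \<Longrightarrow> piece (conv_join \<gamma> \<rho>) (N + N) (N + i) = piece \<rho> N i"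
proof -
  assume i: "i < N"
  have "segment (conv_join \<gamma> \<rho>) (real i / real (N + N)) (real (Suc i) / real (N + N)) =
      segment \<gamma> (2 * (real i / real (N + N))) (2 * (real (Suc i) / real (N + N)))"
    using i by (intro segment_conv_join_left) (auto simp: divide_simps)
  moreover have "2 * (real j / real (N + N)) = real j / real N" for j
    using assms(1) by (simp add: field_simps)
  ultimately show "piece (conv_join \<gamma> \<rho>) (N + N) i = piece \<gamma> N i"
    by (simp only: piece_def)
next
  assume i: "i < N"
  have "segment (conv_join \<gamma> \<rho>) (real (N + i) / real (N + N)) (real (N + Suc i) / real (N + N)) =
      segment \<rho> (2 * (real (N + i) / real (N + N)) - 1) (2 * (real (N + Suc i) / real (N + N)) - 1)"
    using i assms by (intro segment_conv_join_right) (auto simp: divide_simps)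
  moreover have "2 * (real (N + j) / real (N + N)) - 1 = real j / real N" for j
    using assms(1) by (simp add: field_simps)
  ultimately show "piece (conv_join \<gamma> \<rho>) (N + N) (N + i) = piece \<rho> N i"
    by (simp only: piece_def add_Suc_right[symmetric])
qed

lemma piece_image: "piece \<gamma> N i ` {0..1} = \<gamma> ` {real i / real N..real (Suc i) / real N}"
proof -
  have "linepath (real i / real N) (real (Suc i) / real N) ` {0..1} = {real i / real N..real (Suc i) / real N}"
    using cell_bounds[of i N] by (simp only: linepath_image_01 closed_segment_eq_real_ivl if_True)
  moreover have "piece \<gamma> N i ` {0..1} = \<gamma> ` linepath (real i / real N) (real (Suc i) / real N) ` {0..1}"
    by (auto simp: piece_def segment_def)
  ultimately show ?thesis by simp
qed

text \<open>
  The triangle identity for the points \<open>0, i/N, (i+1)/N\<close> telescopes.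
\<close>

lemma path_arrow_chain_comp_pieces:
  assumes lim: "limit_space X L" and \<gamma>: "\<gamma> \<in> lim_paths X L" and "0 < N"
  shows "path_arrow X L \<gamma> =
    chain_comp (fundamental_groupoid X L) (\<gamma> 0) (\<lambda>i. path_arrow X L (piece \<gamma> N i)) N"
proof -
  define b where "b i j = path_arrow X L (segment \<gamma> (real i / real N) (real j / real N))" for i j
  have c: "lim_continuous_on {0..1} X L \<gamma>" using \<gamma> by (simp add: lim_paths_def)
  have "chain_comp (fundamental_groupoid X L) (\<gamma> 0) (\<lambda>i. b i (Suc i)) N = b 0 N"
  proof (rule chain_comp_telescope)
    show "b 0 0 = Id (fundamental_groupoid X L) (\<gamma> 0)"
      by (simp add: b_def Id_eq_path_arrow_segment)
    fix i assume "i < N"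
    then show "Comp (fundamental_groupoid X L) (b i (Suc i)) (b 0 i) = b 0 (Suc i)"
      unfolding b_def using grid_mem[of _ N] by (intro Comp_segments[OF lim c]) (auto simp del: of_nat_Suc)
  qed
  then show ?thesis
    using segment_0_1[OF \<gamma>] assms(3) by (simp add: b_def piece_def)
qed

section \<open>Subdivisions subordinate to a convergence system\<close>

text \<open>
  The image of the neighbourhood filter converges, hence contains a member of the system.
\<close>

lemma convergence_system_nbhd:
  assumes lim: "limit_space X L" and sys: "convergence_system X L \<O>"
    and f: "lim_continuous_on S X L f" and s: "s \<in> S"
  obtains W U where "open W" "s \<in> W" "U \<in> \<O>" "f ` (W \<inter> S) \<subseteq> U"
proof -
  have "proper_on X (filtermap f (nbhds_in S s))"
    using f nbhds_in_neq_bot[OF s]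
    by (intro proper_on_filtermap[where S = S]) (auto simp: lim_continuous_on_def)
  moreover have "f s \<in> X" "f s \<in> L (filtermap f (nbhds_in S s))"
    using f s by (auto simp: lim_continuous_on_def)
  ultimately obtain U where "U \<in> \<O>" "eventually (\<lambda>y. y \<in> U) (filtermap f (nbhds_in S s))"
    using sys unfolding convergence_system_def by blast
  then show thesis
    using that unfolding eventually_filtermap eventually_inf_principal eventually_nhds by fast
qed

lemma convergence_system_Lebesgue:
  fixes f :: "'b::heine_borel \<Rightarrow> 'a"
  assumes lim: "limit_space X L" and sys: "convergence_system X L \<O>"
    and f: "lim_continuous_on S X L f" and S: "compact S" "S \<noteq> {}"
  obtains e where "0 < e" "\<And>T. T \<subseteq> S \<Longrightarrow> diameter T < e \<Longrightarrow> \<exists>U\<in>\<O>. f ` T \<subseteq> U"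
proof -
  define \<W> where "\<W> = {W. open W \<and> (\<exists>U\<in>\<O>. f ` (W \<inter> S) \<subseteq> U)}"
  have cover: "\<exists>W\<in>\<W>. s \<in> W" if "s \<in> S" for s
    by (rule convergence_system_nbhd[OF lim sys f that]) (auto simp: \<W>_def)
  obtain e where e: "0 < e" "\<And>T. T \<subseteq> S \<Longrightarrow> diameter T < e \<Longrightarrow> \<exists>W\<in>\<W>. T \<subseteq> W"
  proof (rule Lebesgue_number_lemma[OF S(1), of \<W>])
    show "\<W> \<noteq> {}" "S \<subseteq> \<Union>\<W>" using cover S(2) by auto
  qed (auto simp: \<W>_def)
  have "\<exists>U\<in>\<O>. f ` T \<subseteq> U" if T: "T \<subseteq> S" "diameter T < e" for T
  proof -
    obtain W where "W \<in> \<W>" "T \<subseteq> W" using e(2)[OF T] by blast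
    moreover from this obtain U where "U \<in> \<O>" "f ` (W \<inter> S) \<subseteq> U" by (auto simp: \<W>_def)
    ultimately show ?thesis using T(1) by blast
  qed
  then show thesis using that e(1) by blast
qed

definition subordinate :: "'a set set \<Rightarrow> (real \<Rightarrow> 'a) \<Rightarrow> nat \<Rightarrow> bool" where
  "subordinate \<O> \<gamma> N \<longleftrightarrow> 0 < N \<and>
     (\<forall>i<N. \<exists>U\<in>\<O>. \<gamma> ` {real i / real N..real (Suc i) / real N} \<subseteq> U)"

lemma subordinate_iff: "subordinate \<O> \<gamma> N \<longleftrightarrow> 0 < N \<and> (\<forall>i<N. \<exists>U\<in>\<O>. piece \<gamma> N i ` {0..1} \<subseteq> U)"
  by (simp add: subordinate_def piece_image)

text \<open>
  A cell of the grid has diameter at most \<open>2/N\<close>, which is below the Lebesgue number for large \<open>N\<close>.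
\<close>

lemma square_grid_exists:
  assumes lim: "limit_space X L" and sys: "convergence_system X L \<O>"
    and h: "lim_continuous_on unit_square X L h"
  obtains N where "0 < N" "\<And>i j. i < N \<Longrightarrow> j < N \<Longrightarrow> \<exists>U\<in>\<O>.
    h ` ({real i / real N..real (Suc i) / real N} \<times> {real j / real N..real (Suc j) / real N}) \<subseteq> U"
proof -
  have sq: "compact unit_square" "unit_square \<noteq> {}" by (auto intro: compact_Times)
  obtain e where e: "0 < e" "\<And>T. T \<subseteq> unit_square \<Longrightarrow> diameter T < e \<Longrightarrow> \<exists>U\<in>\<O>. h ` T \<subseteq> U"
    by (rule convergence_system_Lebesgue[OF lim sys h sq]) blast
  obtain N where N: "2 / e < real N" using reals_Archimedean2 by blast
  have "0 < 2 / e" using e(1) by simp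
  then have N0: "0 < real N" using N by linarith
  have "\<exists>U\<in>\<O>. h ` ({real i / real N..real (Suc i) / real N} \<times> {real j / real N..real (Suc j) / real N}) \<subseteq> U"
    if ij: "i < N" "j < N" for i j
  proof (rule e(2))
    let ?T = "{real i / real N..real (Suc i) / real N} \<times> {real j / real N..real (Suc j) / real N}"
    show "?T \<subseteq> unit_square"
      using cell_subset ij by (intro Sigma_mono) auto
    have "diameter ?T \<le> 2 / real N"
    proof (rule diameter_le)
      fix u v assume uv: "u \<in> ?T" "v \<in> ?T"
      have width: "real (Suc n) / real N = real n / real N + 1 / real N" for n
        by (simp add: add_divide_distrib)
      have "\<bar>fst u - fst v\<bar> \<le> 1 / real N" "\<bar>snd u - snd v\<bar> \<le> 1 / real N"
        using uv unfolding width by auto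
      moreover have "norm (u - v) \<le> \<bar>fst u - fst v\<bar> + \<bar>snd u - snd v\<bar>"
        by (metis fst_diff snd_diff norm_Pair_le prod.collapse real_norm_def)
      ultimately show "norm (u - v) \<le> 2 / real N" by simp
    qed (use N0 in simp)
    also have "\<dots> < e" using N N0 e(1) by (simp add: field_simps)
    finally show "diameter ?T < e" .
  qed
  then show thesis using that[of N] N0 by simp
qed

text \<open>
  The path is regarded as a map on the square that is constant in the first variable; its grid
  restricts to one of the interval.
\<close>

lemma subordinate_exists:
  assumes lim: "limit_space X L" and sys: "convergence_system X L \<O>" and \<gamma>: "\<gamma> \<in> lim_paths X L"
  obtains N where "subordinate \<O> \<gamma> N"
proof -
  have "lim_continuous_on {0..1} X L \<gamma>" using \<gamma> by (simp add: lim_paths_def)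
  then have "lim_continuous_on unit_square X L (\<lambda>u. \<gamma> (snd u))"
    by (rule lim_continuous_on_compose[OF lim]) (auto intro!: continuous_intros)
  then obtain N where N: "0 < N" "\<And>i j. i < N \<Longrightarrow> j < N \<Longrightarrow> \<exists>U\<in>\<O>. (\<lambda>u. \<gamma> (snd u)) `
      ({real i / real N..real (Suc i) / real N} \<times> {real j / real N..real (Suc j) / real N}) \<subseteq> U"
    by (rule square_grid_exists[OF lim sys]) blast
  have "\<exists>U\<in>\<O>. \<gamma> ` {real j / real N..real (Suc j) / real N} \<subseteq> U" if j: "j < N" for j
  proof -
    obtain U where U: "U \<in> \<O>" "(\<lambda>u. \<gamma> (snd u)) `
        ({real 0 / real N..real (Suc 0) / real N} \<times> {real j / real N..real (Suc j) / real N}) \<subseteq> U"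
      using N(2)[OF N(1) j] by blast
    have "\<gamma> t \<in> U" if "t \<in> {real j / real N..real (Suc j) / real N}" for t
      using subsetD[OF U(2) imageI, of "(0, t)"] that by simp
    then show ?thesis using U(1) by blast
  qed
  then show thesis using that N(1) by (auto simp: subordinate_def)
qed

lemma subordinate_refine:
  assumes "subordinate \<O> \<gamma> N" "0 < M"
  shows "subordinate \<O> \<gamma> (N * M)"
  unfolding subordinate_def
proof (intro conjI allI impI)
  show "0 < N * M" using assms by (simp add: subordinate_def)
  fix i assume i: "i < N * M"
  \<comment> \<open>the cell of the coarse grid that contains the \<open>i\<close>-th cell of the fine one\<close>
  define j where "j = i div M"
  have j: "j < N" using i by (simp add: j_def less_mult_imp_div_less)
  have "j * M \<le> i" "Suc i \<le> Suc j * M"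
    using assms(2) dividend_less_div_times[of M i] by (simp_all add: j_def Suc_leI add.commute)
  then have "real j * real M \<le> real i" "real (Suc i) \<le> real (Suc j) * real M"
    by (metis of_nat_le_iff of_nat_mult)+
  then have "real j / real N \<le> real i / real (N * M)" "real (Suc i) / real (N * M) \<le> real (Suc j) / real N"
    using assms by (simp_all add: subordinate_def field_simps del: of_nat_Suc)
  then have "{real i / real (N * M)..real (Suc i) / real (N * M)} \<subseteq> {real j / real N..real (Suc j) / real N}"
    by auto
  moreover obtain U where "U \<in> \<O>" "\<gamma> ` {real j / real N..real (Suc j) / real N} \<subseteq> U"
    using assms(1) j by (auto simp: subordinate_def)
  ultimately show "\<exists>U\<in>\<O>. \<gamma> ` {real i / real (N * M)..real (Suc i) / real (N * M)} \<subseteq> U" by blast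
qed

lemma subordinate_conv_join:
  assumes "subordinate \<O> \<gamma> N" "subordinate \<O> \<rho> N" "\<gamma> 1 = \<rho> 0"
  shows "subordinate \<O> (conv_join \<gamma> \<rho>) (N + N)"
  unfolding subordinate_iff
proof (intro conjI allI impI)
  have N: "0 < N" using assms(1) by (simp add: subordinate_def)
  then show "0 < N + N" by simp
  fix i assume i: "i < N + N"
  show "\<exists>U\<in>\<O>. piece (conv_join \<gamma> \<rho>) (N + N) i ` {0..1} \<subseteq> U"
  proof (cases "i < N")
    case True
    then show ?thesis
      using assms(1) unfolding subordinate_iff by (simp add: piece_conv_join(1)[where N = N and \<gamma> = \<gamma> and \<rho> = \<rho>, OF N assms(3)])
  next
    case False
    then have "i = N + (i - N)" "i - N < N" using i by auto
    then show ?thesis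
      using assms(2) piece_conv_join(2)[where N = N and \<gamma> = \<gamma> and \<rho> = \<rho>, OF N assms(3), of "i - N"] unfolding subordinate_iff by simp
  qed
qed

section \<open>Subspaces and their inclusions\<close>

abbreviation subspace_groupoid :: "('a filter \<Rightarrow> 'a set) \<Rightarrow> 'a set \<Rightarrow> ('a, 'a pi_arrow) cat" where
  "subspace_groupoid L U \<equiv> fundamental_groupoid U (subspace_conv L U)"

abbreviation inclusion_functor ::
  "('a filter \<Rightarrow> 'a set) \<Rightarrow> 'a set \<Rightarrow> 'a set \<Rightarrow> ('a, 'a pi_arrow, 'a, 'a pi_arrow) cat_map" where
  "inclusion_functor L U V \<equiv> fundamental_functor U (subspace_conv L U) V (subspace_conv L V) (\<lambda>x. x)"

abbreviation subspace_arrow :: "('a filter \<Rightarrow> 'a set) \<Rightarrow> 'a set \<Rightarrow> (real \<Rightarrow> 'a) \<Rightarrow> 'a pi_arrow" where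
  "subspace_arrow L U \<equiv> path_arrow U (subspace_conv L U)"

lemma on_arr_inclusion_functor:
  assumes "limit_space X L" "U \<subseteq> V" "V \<subseteq> X" "\<gamma> \<in> lim_paths X L" "\<gamma> ` {0..1} \<subseteq> U"
  shows "on_arr (inclusion_functor L U V) (subspace_arrow L U \<gamma>) = subspace_arrow L V \<gamma>"
proof -
  have "limit_space U (subspace_conv L U)" "limit_space V (subspace_conv L V)"
    using limit_space_subspace[OF assms(1)] assms(2,3) by auto
  moreover have "\<gamma> \<in> lim_paths U (subspace_conv L U)"
    using assms by (simp add: lim_paths_subspace_iff[of U X])
  moreover note compose_ident_lim_path[OF assms(4)]
  ultimately show ?thesis
    using on_arr_fundamental_functor[OF _ _ conv_continuous_inclusion[OF assms(2)]] by simp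
qed

lemma on_arr_inclusion_functor_total:
  assumes "limit_space X L" "U \<subseteq> X" "\<gamma> \<in> lim_paths X L" "\<gamma> ` {0..1} \<subseteq> U"
  shows "on_arr (fundamental_functor U (subspace_conv L U) X L (\<lambda>x. x)) (subspace_arrow L U \<gamma>) =
    path_arrow X L \<gamma>"
proof -
  have "limit_space U (subspace_conv L U)"
    using limit_space_subspace[OF assms(1,2)] .
  moreover have "\<gamma> \<in> lim_paths U (subspace_conv L U)"
    using assms by (simp add: lim_paths_subspace_iff[of U X])
  moreover note compose_ident_lim_path[OF assms(3)]
  ultimately show ?thesis
    using on_arr_fundamental_functor[OF _ assms(1) conv_continuous_inclusion_total[OF assms(2)]] by simp
qed

lemma inclusion_category_simps [simp]:
  "Obj (inclusion_category \<O>) = \<O>"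
  "Arr (inclusion_category \<O>) = {(U, V). U \<in> \<O> \<and> V \<in> \<O> \<and> U \<subseteq> V}"
  "Dom (inclusion_category \<O>) = fst"
  "Cod (inclusion_category \<O>) = snd"
  "Id (inclusion_category \<O>) U = (U, U)"
  "Comp (inclusion_category \<O>) v u = (fst u, snd v)"
  by (simp_all add: inclusion_category_def)

lemma is_category_inclusion_category: "is_category (inclusion_category \<O>)"
  by (auto simp: is_category_def)

lemma groupoid_diagram_subspaces:
  assumes lim: "limit_space X L" and sub: "\<And>U. U \<in> \<O> \<Longrightarrow> U \<subseteq> X"
  shows "groupoid_diagram (inclusion_category \<O>) (subspace_groupoid L) (\<lambda>(U, V). inclusion_functor L U V)"
  unfolding groupoid_diagram_def inclusion_category_simps
proof (intro conjI ballI impI)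
  have sp: "limit_space U (subspace_conv L U)" if "U \<in> \<O>" for U
    using limit_space_subspace[OF lim sub[OF that]] .
  show "is_category (inclusion_category \<O>)" by (rule is_category_inclusion_category)
  show "is_groupoid (subspace_groupoid L U)"
    and "(case (U, U) of (U, V) \<Rightarrow> inclusion_functor L U V) = id_functor (subspace_groupoid L U)"
    if "U \<in> \<O>" for U
    using is_groupoid_fundamental_groupoid[OF sp[OF that]] fundamental_functor_id[OF sp[OF that]] by simp_all
  fix u assume u: "u \<in> {(U, V). U \<in> \<O> \<and> V \<in> \<O> \<and> U \<subseteq> V}"
  then obtain U V where [simp]: "u = (U, V)" and UV: "U \<in> \<O>" "V \<in> \<O>" "U \<subseteq> V" by blast
  show "is_functor (subspace_groupoid L (fst u)) (subspace_groupoid L (snd u))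
      (case u of (U, V) \<Rightarrow> inclusion_functor L U V)"
    using is_functor_fundamental_functor[OF sp sp conv_continuous_inclusion] UV by simp
  fix v assume v: "v \<in> {(U, V). U \<in> \<O> \<and> V \<in> \<O> \<and> U \<subseteq> V}" and "snd u = fst v"
  then obtain W where [simp]: "v = (V, W)" and W: "W \<in> \<O>" "V \<subseteq> W" by auto
  have "comp_functor (subspace_groupoid L U) (inclusion_functor L V W) (inclusion_functor L U V) =
      inclusion_functor L U W"
    using UV W by (intro comp_fundamental_functor sp conv_continuous_inclusion) auto
  then show "(case (fst u, snd v) of (U, V) \<Rightarrow> inclusion_functor L U V) =
      comp_functor (subspace_groupoid L (fst u)) (case v of (U, V) \<Rightarrow> inclusion_functor L U V)
        (case u of (U, V) \<Rightarrow> inclusion_functor L U V)"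
    by simp
qed

lemma groupoid_cocone_total_space:
  assumes lim: "limit_space X L" and sub: "\<And>U. U \<in> \<O> \<Longrightarrow> U \<subseteq> X"
  shows "groupoid_cocone (inclusion_category \<O>) (subspace_groupoid L) (\<lambda>(U, V). inclusion_functor L U V)
    (fundamental_groupoid X L) (\<lambda>U. fundamental_functor U (subspace_conv L U) X L (\<lambda>x. x))"
  unfolding groupoid_cocone_def inclusion_category_simps
proof (intro conjI ballI)
  have sp: "limit_space U (subspace_conv L U)" if "U \<in> \<O>" for U
    using limit_space_subspace[OF lim sub[OF that]] .
  show "is_groupoid (fundamental_groupoid X L)" by (rule is_groupoid_fundamental_groupoid[OF lim])
  show "is_functor (subspace_groupoid L U) (fundamental_groupoid X L)
      (fundamental_functor U (subspace_conv L U) X L (\<lambda>x. x))" if "U \<in> \<O>" for U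
    using that by (intro is_functor_fundamental_functor sp lim conv_continuous_inclusion_total sub)
  fix u assume "u \<in> {(U, V). U \<in> \<O> \<and> V \<in> \<O> \<and> U \<subseteq> V}"
  then obtain U V where [simp]: "u = (U, V)" and UV: "U \<in> \<O>" "V \<in> \<O>" "U \<subseteq> V" by blast
  have "comp_functor (subspace_groupoid L U) (fundamental_functor V (subspace_conv L V) X L (\<lambda>x. x))
      (inclusion_functor L U V) = fundamental_functor U (subspace_conv L U) X L (\<lambda>x. x)"
    using UV
    by (intro comp_fundamental_functor sp lim conv_continuous_inclusion conv_continuous_inclusion_total sub)
  then show "comp_functor (subspace_groupoid L (fst u))
      (fundamental_functor (snd u) (subspace_conv L (snd u)) X L (\<lambda>x. x))
      (case u of (U, V) \<Rightarrow> inclusion_functor L U V) =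
    fundamental_functor (fst u) (subspace_conv L (fst u)) X L (\<lambda>x. x)"
    by simp
qed

section \<open>Values of a cocone on paths\<close>

locale groupoid_cocone_on_system =
  fixes X :: "'a set" and L :: "'a filter \<Rightarrow> 'a set" and \<O> :: "'a set set"
    and K :: "('q, 'l) cat" and k :: "'a set \<Rightarrow> ('a, 'a pi_arrow, 'q, 'l) cat_map"
  assumes lim: "limit_space X L" and sys: "convergence_system X L \<O>"
    and Int_closed: "\<And>U V. U \<in> \<O> \<Longrightarrow> V \<in> \<O> \<Longrightarrow> U \<inter> V \<in> \<O>"
    and cocone: "groupoid_cocone (inclusion_category \<O>) (subspace_groupoid L)
      (\<lambda>(U, V). inclusion_functor L U V) K k"
begin

lemma subset_X: "U \<in> \<O> \<Longrightarrow> U \<subseteq> X"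
  using sys by (simp add: convergence_system_def)

lemma limit_space_member: "U \<in> \<O> \<Longrightarrow> limit_space U (subspace_conv L U)"
  using limit_space_subspace[OF lim subset_X] .

lemma K_category: "is_category K"
  using cocone by (simp add: groupoid_cocone_def is_groupoid_def)

lemma functor_k: "U \<in> \<O> \<Longrightarrow> is_functor (subspace_groupoid L U) K (k U)"
  using cocone by (simp add: groupoid_cocone_def inclusion_category_def)

lemma k_compatible:
  assumes "U \<in> \<O>" "V \<in> \<O>" "U \<subseteq> V"
  shows "comp_functor (subspace_groupoid L U) (k V) (inclusion_functor L U V) = k U"
  using cocone assms by (auto simp: groupoid_cocone_def inclusion_category_def)

lemma on_obj_k_mono:
  assumes "U \<in> \<O>" "V \<in> \<O>" "U \<subseteq> V" "x \<in> U"
  shows "on_obj (k V) x = on_obj (k U) x"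
proof -
  have "on_obj (comp_functor (subspace_groupoid L U) (k V) (inclusion_functor L U V)) x = on_obj (k V) x"
    using assms by (simp add: comp_functor_def compose_def fundamental_functor_def)
  then show ?thesis by (simp add: k_compatible assms)
qed

lemma subspace_arrow_in_Arr:
  assumes "U \<in> \<O>" "\<delta> \<in> lim_paths X L" "\<delta> ` {0..1} \<subseteq> U"
  shows "subspace_arrow L U \<delta> \<in> Arr (subspace_groupoid L U)"
  using assms by (simp add: Arr_fundamental_groupoid[OF limit_space_member] lim_paths_subspace_iff[OF subset_X])

lemma on_arr_k_mono:
  assumes "U \<in> \<O>" "V \<in> \<O>" "U \<subseteq> V" "\<delta> \<in> lim_paths X L" "\<delta> ` {0..1} \<subseteq> U"
  shows "on_arr (k V) (subspace_arrow L V \<delta>) = on_arr (k U) (subspace_arrow L U \<delta>)"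
proof -
  have "on_arr (comp_functor (subspace_groupoid L U) (k V) (inclusion_functor L U V)) (subspace_arrow L U \<delta>) =
      on_arr (k V) (subspace_arrow L V \<delta>)"
    using subspace_arrow_in_Arr[OF assms(1,4,5)]
      on_arr_inclusion_functor[OF lim assms(3) subset_X[OF assms(2)] assms(4,5)]
    by (simp add: comp_functor_def compose_def)
  then show ?thesis by (simp add: k_compatible assms)
qed

text \<open>
  The choice is harmless by \<open>glued_obj_eq\<close>, as is the one in the value of a small path by
  \<open>local_arrow_eq\<close>: closure under intersections makes any two members comparable with a third.
\<close>

definition glued_obj :: "'a \<Rightarrow> 'q" where
  "glued_obj x = on_obj (k (SOME U. U \<in> \<O> \<and> x \<in> U)) x"

lemma glued_obj_eq:
  assumes U: "U \<in> \<O>" "x \<in> U"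
  shows "glued_obj x = on_obj (k U) x"
proof -
  define V where "V = (SOME U. U \<in> \<O> \<and> x \<in> U)"
  have V: "V \<in> \<O>" "x \<in> V"
    using someI[of "\<lambda>U. U \<in> \<O> \<and> x \<in> U" U] U by (auto simp: V_def)
  have "on_obj (k V) x = on_obj (k (U \<inter> V)) x" "on_obj (k U) x = on_obj (k (U \<inter> V)) x"
    using U V Int_closed by (auto intro!: on_obj_k_mono)
  then show ?thesis by (simp add: glued_obj_def V_def)
qed

text \<open>
  The principal filter of a point converges to it and contains only sets through that point.
\<close>

lemma member_exists:
  assumes "x \<in> X"
  obtains U where "U \<in> \<O>" "x \<in> U"
proof -
  have "proper_on X (principal {x})" "x \<in> L (principal {x})"
    using lim assms by (auto simp: limit_space_def centered_def proper_on_def principal_eq_bot_iff)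
  then obtain U where "U \<in> \<O>" "eventually (\<lambda>y. y \<in> U) (principal {x})"
    using sys assms unfolding convergence_system_def by blast
  then show thesis using that by (simp add: eventually_principal)
qed

lemma glued_obj_in_Obj:
  assumes "x \<in> X"
  shows "glued_obj x \<in> Obj K"
proof -
  obtain U where U: "U \<in> \<O>" "x \<in> U" using member_exists[OF assms] .
  then show ?thesis
    using functor_k[OF U(1)] by (auto simp: glued_obj_eq[OF U] is_functor_def)
qed

definition local_arrow :: "(real \<Rightarrow> 'a) \<Rightarrow> 'l" where
  "local_arrow \<delta> = (let U = SOME U. U \<in> \<O> \<and> \<delta> ` {0..1} \<subseteq> U in on_arr (k U) (subspace_arrow L U \<delta>))"

lemma local_arrow_eq:
  assumes U: "U \<in> \<O>" "\<delta> ` {0..1} \<subseteq> U" and \<delta>: "\<delta> \<in> lim_paths X L"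
  shows "local_arrow \<delta> = on_arr (k U) (subspace_arrow L U \<delta>)"
proof -
  define V where "V = (SOME U. U \<in> \<O> \<and> \<delta> ` {0..1} \<subseteq> U)"
  have V: "V \<in> \<O>" "\<delta> ` {0..1} \<subseteq> V"
    using someI[of "\<lambda>U. U \<in> \<O> \<and> \<delta> ` {0..1} \<subseteq> U" U] U by (auto simp: V_def)
  have "on_arr (k W) (subspace_arrow L W \<delta>) = on_arr (k (U \<inter> V)) (subspace_arrow L (U \<inter> V) \<delta>)"
    if "W \<in> {U, V}" for W
    using U V Int_closed \<delta> that by (intro on_arr_k_mono) auto
  then show ?thesis by (simp add: local_arrow_def V_def Let_def)
qed

lemma local_arrow_in_hom:
  assumes U: "U \<in> \<O>" "\<delta> ` {0..1} \<subseteq> U" and \<delta>: "\<delta> \<in> lim_paths X L"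
  shows "local_arrow \<delta> \<in> hom K (glued_obj (\<delta> 0)) (glued_obj (\<delta> 1))"
proof -
  have "subspace_arrow L U \<delta> \<in> hom (subspace_groupoid L U) (\<delta> 0) (\<delta> 1)"
    using subspace_arrow_in_Arr[OF U(1) \<delta> U(2)] by (simp add: hom_def)
  moreover have "\<delta> 0 \<in> U" "\<delta> 1 \<in> U" using U(2) by auto
  ultimately show ?thesis
    using functor_in_hom[OF functor_k[OF U(1)]] local_arrow_eq[OF assms] glued_obj_eq[OF U(1)] by simp
qed

context
  fixes S :: "'b::real_normed_vector set" and f U
  assumes U: "U \<in> \<O>" "f ` S \<subseteq> U" and f: "lim_continuous_on S X L f" and S: "convex S"
begin

lemma segment_lim_continuous_member: "lim_continuous_on S U (subspace_conv L U) f"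
  using f U by (auto simp: lim_continuous_on_subspace_iff[OF subset_X])

lemma local_arrow_segment_eq:
  assumes "p \<in> S" "q \<in> S"
  shows "local_arrow (segment f p q) = on_arr (k U) (subspace_arrow L U (segment f p q))"
  using segment_image_subset[OF S assms U(2)] segment_in_lim_paths[OF lim f S assms]
  by (rule local_arrow_eq[OF U(1)])

lemma local_arrow_segment_in_hom:
  assumes "p \<in> S" "q \<in> S"
  shows "local_arrow (segment f p q) \<in> hom K (glued_obj (f p)) (glued_obj (f q))"
  using local_arrow_in_hom[OF U(1) segment_image_subset[OF S assms U(2)] segment_in_lim_paths[OF lim f S assms]]
  by simp

lemma local_arrow_triangle:
  assumes "p \<in> S" "q \<in> S" "r \<in> S"
  shows "Comp K (local_arrow (segment f q r)) (local_arrow (segment f p q)) = local_arrow (segment f p r)"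
proof -
  note c = segment_lim_continuous_member
  note L = limit_space_member[OF U(1)]
  have "on_arr (k U) (Comp (subspace_groupoid L U) (subspace_arrow L U (segment f q r))
      (subspace_arrow L U (segment f p q))) =
    Comp K (on_arr (k U) (subspace_arrow L U (segment f q r)))
      (on_arr (k U) (subspace_arrow L U (segment f p q)))"
    by (rule functor_Comp[OF functor_k[OF U(1)] path_arrow_segment_in_hom[OF L c S assms(1,2)]
          path_arrow_segment_in_hom[OF L c S assms(2,3)]])
  then show ?thesis
    using Comp_segments[OF L c S assms] assms by (simp add: local_arrow_segment_eq)
qed

lemma local_arrow_const:
  assumes "p \<in> S"
  shows "local_arrow (segment f p p) = Id K (glued_obj (f p))"
proof -
  have "f p \<in> U" using U(2) assms by blast
  then have "on_arr (k U) (Id (subspace_groupoid L U) (f p)) = Id K (glued_obj (f p))"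
    using functor_k[OF U(1)] glued_obj_eq[OF U(1)] by (simp add: is_functor_def)
  then show ?thesis
    using assms by (simp add: local_arrow_segment_eq Id_eq_path_arrow_segment)
qed

end

text \<open>
  The composite is meaningful when the subdivision is subordinate to the system; otherwise some
  pieces have an arbitrary value.
\<close>

definition path_value :: "(real \<Rightarrow> 'a) \<Rightarrow> nat \<Rightarrow> 'l" where
  "path_value \<gamma> N = chain_comp K (glued_obj (\<gamma> 0)) (\<lambda>i. local_arrow (piece \<gamma> N i)) N"

lemma lim_continuous_on_cell:
  assumes "\<gamma> \<in> lim_paths X L" "i < N"
  shows "lim_continuous_on {real i / real N..real (Suc i) / real N} X L \<gamma>"
  using lim_continuous_on_subset[OF lim _ cell_subset[OF assms(2)]] assms(1)
  unfolding lim_paths_def by blast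

lemma local_arrow_piece_in_hom:
  assumes "\<gamma> \<in> lim_paths X L" "subordinate \<O> \<gamma> N" "i < N"
  shows "local_arrow (piece \<gamma> N i) \<in>
    hom K (glued_obj (\<gamma> (real i / real N))) (glued_obj (\<gamma> (real (Suc i) / real N)))"
proof -
  obtain U where U: "U \<in> \<O>" "\<gamma> ` {real i / real N..real (Suc i) / real N} \<subseteq> U"
    using assms(2,3) by (auto simp: subordinate_def)
  show ?thesis
    unfolding piece_def using cell_bounds
    by (intro local_arrow_segment_in_hom[OF U lim_continuous_on_cell[OF assms(1,3)]]) auto
qed


lemma path_value_in_hom:
  assumes \<gamma>: "\<gamma> \<in> lim_paths X L" and N: "subordinate \<O> \<gamma> N"
  shows "path_value \<gamma> N \<in> hom K (glued_obj (\<gamma> 0)) (glued_obj (\<gamma> 1))"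
proof -
  have "0 < N" using N by (simp add: subordinate_def)
  have "chain_comp K (glued_obj (\<gamma> (real 0 / real N))) (\<lambda>i. local_arrow (piece \<gamma> N i)) N \<in>
      hom K (glued_obj (\<gamma> (real 0 / real N))) (glued_obj (\<gamma> (real N / real N)))"
    using lim_paths_mem[OF \<gamma>] local_arrow_piece_in_hom[OF assms]
    by (intro chain_comp_in_hom[OF K_category, of "\<lambda>i. glued_obj (\<gamma> (real i / real N))"] glued_obj_in_Obj) simp_all
  then show ?thesis using \<open>0 < N\<close> by (simp add: path_value_def)
qed

text \<open>
  The \<open>N * M\<close> pieces are grouped into \<open>N\<close> blocks of \<open>M\<close>. A block stays in one member, so there the
  triangle identity holds and the block telescopes to a single piece of the coarse subdivision.
\<close>

lemma path_value_refine:
  assumes \<gamma>: "\<gamma> \<in> lim_paths X L" and N: "subordinate \<O> \<gamma> N" and M: "0 < M"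
  shows "path_value \<gamma> (N * M) = path_value \<gamma> N"
proof -
  let ?NM = "real (N * M)"
  define a where "a = (\<lambda>i. local_arrow (piece \<gamma> (N * M) i))"
  \<comment> \<open>clamping makes every point of the infinite grid a point of the path\<close>
  define p where "p i = glued_obj (\<gamma> (min 1 (real i / ?NM)))" for i
  have N0: "0 < N" using N by (simp add: subordinate_def)
  have NM0: "0 < ?NM" using N0 M by simp
  have clamp: "min 1 (real i / ?NM) = real i / ?NM" if "i \<le> N * M" for i
    using grid_mem[OF that] by (intro min_absorb2) (simp only: atLeastAtMost_iff)
  have "path_value \<gamma> (N * M) = chain_comp K (p 0) a (N * M)"
    by (simp add: path_value_def p_def a_def)
  also have "\<dots> = chain_comp K (p 0) (\<lambda>i. chain_comp K (p (i * M)) (\<lambda>j. a (i * M + j)) M) N"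
  proof (rule chain_comp_blocks[OF K_category])
    show "p i \<in> Obj K" for i
      unfolding p_def using lim_paths_mem[OF \<gamma>] by (intro glued_obj_in_Obj) auto
    show "a i \<in> hom K (p i) (p (Suc i))" if "i < N * M" for i
      using local_arrow_piece_in_hom[OF \<gamma> subordinate_refine[OF N M] that] that
      unfolding a_def p_def by (simp only: clamp Suc_leI less_imp_le)
  qed
  also have "\<dots> = chain_comp K (p 0) (\<lambda>i. local_arrow (piece \<gamma> N i)) N"
  proof (rule chain_comp_cong[OF refl refl])
    fix i assume i: "i < N"
    obtain U where U: "U \<in> \<O>" "\<gamma> ` {real i / real N..real (Suc i) / real N} \<subseteq> U"
      using N i by (auto simp: subordinate_def)
    define g where "g j = real (i * M + j) / ?NM" for j
    have g_end: "g 0 = real i / real N" "g M = real (Suc i) / real N"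
      using N0 M by (simp_all add: g_def field_simps)
    have g_mem: "g j \<in> {real i / real N..real (Suc i) / real N}" if "j \<le> M" for j
      unfolding atLeastAtMost_iff g_end[symmetric] g_def using that NM0
      by (intro conjI divide_right_mono) auto
    define b where "b j l = local_arrow (segment \<gamma> (g j) (g l))" for j l
    have "chain_comp K (glued_obj (\<gamma> (g 0))) (\<lambda>j. b j (Suc j)) M = b 0 M"
    proof (rule chain_comp_telescope)
      show "b 0 0 = Id K (glued_obj (\<gamma> (g 0)))"
        unfolding b_def by (rule local_arrow_const[OF U lim_continuous_on_cell[OF \<gamma> i]]) (use g_mem in auto)
      show "Comp K (b j (Suc j)) (b 0 j) = b 0 (Suc j)" if "j < M" for j
        unfolding b_def using that
        by (intro local_arrow_triangle[OF U lim_continuous_on_cell[OF \<gamma> i]] g_mem) auto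
    qed
    moreover have "p (i * M) = glued_obj (\<gamma> (g 0))"
      using clamp[of "i * M"] i by (simp add: p_def g_def)
    moreover have "b j (Suc j) = a (i * M + j)" for j
      by (simp add: b_def a_def piece_def g_def)
    ultimately show "chain_comp K (p (i * M)) (\<lambda>j. a (i * M + j)) M = local_arrow (piece \<gamma> N i)"
      by (simp add: b_def g_end piece_def)
  qed
  also have "\<dots> = path_value \<gamma> N"
    by (simp add: path_value_def p_def)
  finally show ?thesis .
qed

lemma path_value_unique:
  assumes "\<gamma> \<in> lim_paths X L" "subordinate \<O> \<gamma> N" "subordinate \<O> \<gamma> M"
  shows "path_value \<gamma> N = path_value \<gamma> M"
  using path_value_refine[OF assms(1,2), of M] path_value_refine[OF assms(1,3), of N] assms(2,3)
  by (simp add: subordinate_def mult.commute)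

text \<open>
  With a grid for the homotopy, \<open>row j\<close> lists the values along the path at time \<open>j/n\<close> and \<open>col j\<close>
  the values of the edges from that path to the next one. Each small square commutes by two
  triangle identities. The two outer edges are constant because the endpoints stay fixed, so their
  values are identities and consecutive rows have equal composites.
\<close>

lemma path_value_homotopic:
  assumes hom: "rel_homotopic X L x y \<gamma> \<rho>" and N: "subordinate \<O> \<gamma> N" and M: "subordinate \<O> \<rho> M"
  shows "path_value \<gamma> N = path_value \<rho> M"
proof -
  obtain h where h: "lim_continuous_on unit_square X L h"
    and bd: "\<forall>t\<in>{0..1}. h (0, t) = \<gamma> t \<and> h (1, t) = \<rho> t \<and> h (t, 0) = x \<and> h (t, 1) = y"
    using hom by (auto simp: rel_homotopic_iff[OF lim])
  obtain n where n: "0 < n" and small: "\<And>i j. i < n \<Longrightarrow> j < n \<Longrightarrow> \<exists>U\<in>\<O>.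
    h ` ({real i / real n..real (Suc i) / real n} \<times> {real j / real n..real (Suc j) / real n}) \<subseteq> U"
    by (rule square_grid_exists[OF lim sys h]) blast
  define g where "g i = real i / real n" for i
  have g_mem: "g i \<in> {0..1}" if "i \<le> n" for i using grid_mem[OF that] by (simp add: g_def)
  have g_end [simp]: "g 0 = 0" "g n = 1" using n by (simp_all add: g_def)
  define row where "row j i = local_arrow (segment h (g j, g i) (g j, g (Suc i)))" for j i
  define col where "col j i = local_arrow (segment h (g j, g i) (g (Suc j), g i))" for j i
  define P where "P j i = glued_obj (h (g j, g i))" for j i
  have hX: "h (g j, g i) \<in> X" if "j \<le> n" "i \<le> n" for j i
    using h g_mem[OF that(1)] g_mem[OF that(2)] by (auto simp: lim_continuous_on_def)
  have square: "row j i \<in> hom K (P j i) (P j (Suc i)) \<and> row (Suc j) i \<in> hom K (P (Suc j) i) (P (Suc j) (Suc i)) \<and>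
      col j i \<in> hom K (P j i) (P (Suc j) i) \<and> col j (Suc i) \<in> hom K (P j (Suc i)) (P (Suc j) (Suc i)) \<and>
      Comp K (row (Suc j) i) (col j i) = Comp K (col j (Suc i)) (row j i)" if ji: "j < n" "i < n" for j i
  proof -
    \<comment> \<open>both composites equal the value along the diagonal of the cell\<close>
    let ?S = "{g j..g (Suc j)} \<times> {g i..g (Suc i)}"
    obtain U where U: "U \<in> \<O>" "h ` ?S \<subseteq> U"
      using small[OF ji] by (auto simp: g_def)
    have "?S \<subseteq> unit_square"
      using cell_subset ji unfolding g_def by (intro Sigma_mono) auto
    then have c: "lim_continuous_on ?S X L h" by (rule lim_continuous_on_subset[OF lim h])
    have S: "convex ?S" by (intro convex_Times) auto
    have corners: "(g j, g i) \<in> ?S" "(g j, g (Suc i)) \<in> ?S" "(g (Suc j), g i) \<in> ?S" "(g (Suc j), g (Suc i)) \<in> ?S"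
      using cell_bounds[of j n] cell_bounds[of i n] by (auto simp: g_def simp del: of_nat_Suc)
    show ?thesis
      unfolding row_def col_def P_def
      using local_arrow_segment_in_hom[OF U c S] local_arrow_triangle[OF U c S] corners by simp
  qed
  have row_hom: "row j i \<in> hom K (P j i) (P j (Suc i))" if "j \<le> n" "i < n" for j i
    using square[of j i] square[of "j - 1" i] that n by (cases "j = n") auto
  have col_hom: "col j i \<in> hom K (P j i) (P (Suc j) i)" if "j < n" "i \<le> n" for j i
    using square[of j i] square[of j "i - 1"] that n by (cases "i = n") auto
  have P_Obj: "P j i \<in> Obj K" if "j \<le> n" "i \<le> n" for j i
    unfolding P_def by (rule glued_obj_in_Obj[OF hX[OF that]])
  define R where "R j = chain_comp K (P j 0) (row j) n" for j
  have R_hom: "R j \<in> hom K (P j 0) (P j n)" if "j \<le> n" for j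
    unfolding R_def using that by (intro chain_comp_in_hom[OF K_category] P_Obj row_hom) auto
  have edge: "local_arrow (segment h (g j, t) (g (Suc j), t)) = Id K (glued_obj (h (g j, t)))"
    if "j < n" "t \<in> {0, 1}" for j t
  proof -
    have eq: "h (s, t) = h (g j, t)" if "s \<in> {0..1}" for s
      using bd that \<open>t \<in> {0, 1}\<close> g_mem[of j] \<open>j < n\<close> by auto
    have "segment h (g j, t) (g (Suc j), t) = segment (\<lambda>_::real. h (g j, t)) 0 0"
    proof (rule segment_cong)
      fix u :: real assume u: "0 \<le> u" "u \<le> 1"
      have "linepath (g j, t) (g (Suc j), t) u = (linepath (g j) (g (Suc j)) u, t)"
        by (simp add: linepath_def algebra_simps)
      moreover have "linepath (g j) (g (Suc j)) u \<in> {0..1}"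
        using g_mem \<open>j < n\<close> u by (intro linepath_mem_convex) auto
      ultimately show "h (linepath (g j, t) (g (Suc j), t) u) = h (g j, t)" using eq by simp
    qed
    moreover have "h (g j, t) \<in> X" using hX[of j 0] hX[of j n] that by auto
    then obtain U where "U \<in> \<O>" "h (g j, t) \<in> U" by (rule member_exists)
    ultimately show ?thesis
      using local_arrow_const[of U "\<lambda>_::real. h (g j, t)" UNIV 0]
        lim_continuous_on_const[OF lim \<open>h (g j, t) \<in> X\<close>] by auto
  qed
  have R_Suc: "R (Suc j) = R j" if "j < n" for j
  proof -
    have "Comp K (chain_comp K (P (Suc j) 0) (row (Suc j)) n) (col j 0) =
        Comp K (col j n) (chain_comp K (P j 0) (row j) n)"
    proof (rule chain_comp_squares[OF K_category])
      show "P j 0 \<in> Obj K" "P (Suc j) 0 \<in> Obj K"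
        using that by (auto intro!: P_Obj)
    qed (use square that row_hom col_hom in auto)
    moreover have "col j 0 = Id K (P j 0)" "col j n = Id K (P j n)"
      using edge[OF that] by (auto simp: col_def P_def)
    moreover have "P (Suc j) 0 = P j 0" "P (Suc j) n = P j n"
      using bd g_mem[of j] g_mem[of "Suc j"] that by (auto simp: P_def)
    ultimately show ?thesis
      using R_hom[of j] R_hom[of "Suc j"] that Comp_Id_left[OF K_category] Comp_Id_right[OF K_category]
      unfolding R_def by (metis Suc_leI less_imp_le)
  qed
  have "R j = R 0" if "j \<le> n" for j
    using that by (induction j) (auto simp: R_Suc)
  then have "R n = R 0" by blast
  have boundary: "R j = path_value \<delta> n \<and> subordinate \<O> \<delta> n"
    if j: "j \<in> {0, n}" and \<delta>: "\<And>t. t \<in> {0..1} \<Longrightarrow> h (g j, t) = \<delta> t" for j \<delta>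
  proof
    have "segment h (g j, g i) (g j, g (Suc i)) = piece \<delta> n i" if "i < n" for i
      unfolding piece_def g_def[symmetric]
    proof (rule segment_cong)
      fix u :: real assume u: "0 \<le> u" "u \<le> 1"
      have "linepath (g j, g i) (g j, g (Suc i)) u = (g j, linepath (g i) (g (Suc i)) u)"
        by (simp add: linepath_def algebra_simps)
      moreover have "linepath (g i) (g (Suc i)) u \<in> {0..1}"
        using g_mem that u by (intro linepath_mem_convex) auto
      ultimately show "h (linepath (g j, g i) (g j, g (Suc i)) u) = \<delta> (linepath (g i) (g (Suc i)) u)"
        using \<delta> by simp
    qed
    then show "R j = path_value \<delta> n"
      using \<delta>[of 0] unfolding R_def path_value_def row_def P_def by (auto intro!: chain_comp_cong)
    show "subordinate \<O> \<delta> n"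
      unfolding subordinate_def
    proof (intro conjI allI impI n)
      fix i assume i: "i < n"
      \<comment> \<open>the row of cells that touches the boundary line, the first or the last one\<close>
      define l where "l = (if j = 0 then 0 else n - 1)"
      have "l < n" using n by (simp add: l_def)
      then obtain U where U: "U \<in> \<O>" "h ` ({g l..g (Suc l)} \<times> {g i..g (Suc i)}) \<subseteq> U"
        using small[OF _ i] unfolding g_def by blast
      have gj: "g j \<in> {g l..g (Suc l)}"
        using j n cell_bounds[of l n] by (auto simp: l_def g_def simp del: of_nat_Suc)
      have "\<delta> t \<in> U" if t: "t \<in> {g i..g (Suc i)}" for t
      proof -
        have "h (g j, t) \<in> U" using gj t by (intro subsetD[OF U(2) imageI]) simp
        moreover have "t \<in> {0..1}" using cell_subset[OF i] t unfolding g_def by blast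
        ultimately show ?thesis using \<delta> by simp
      qed
      then show "\<exists>U\<in>\<O>. \<delta> ` {real i / real n..real (Suc i) / real n} \<subseteq> U"
        using U(1) unfolding g_def by blast
    qed
  qed
  have "R 0 = path_value \<gamma> n \<and> subordinate \<O> \<gamma> n" "R n = path_value \<rho> n \<and> subordinate \<O> \<rho> n"
    by (rule boundary; use bd in simp)+
  moreover have "\<gamma> \<in> lim_paths X L" "\<rho> \<in> lim_paths X L"
    using hom by (auto simp: rel_homotopic_def conv_paths_eq[OF lim])
  ultimately show ?thesis
    using path_value_unique N M \<open>R n = R 0\<close> by metis
qed

text \<open>
  The first \<open>N\<close> of the \<open>2 N\<close> pieces of the concatenation are those of \<open>\<gamma>\<close>, the others those of \<open>\<rho>\<close>.
\<close>

lemma path_value_conv_join: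
  assumes \<gamma>: "\<gamma> \<in> lim_paths X L" and \<rho>: "\<rho> \<in> lim_paths X L" and e: "\<gamma> 1 = \<rho> 0"
    and N: "subordinate \<O> \<gamma> N" "subordinate \<O> \<rho> N"
  shows "path_value (conv_join \<gamma> \<rho>) (N + N) = Comp K (path_value \<rho> N) (path_value \<gamma> N)"
proof -
  let ?j = "conv_join \<gamma> \<rho>"
  have j: "?j \<in> lim_paths X L" by (rule conv_join_in_lim_paths[OF lim \<gamma> \<rho> e])
  have N0: "0 < N" using N(1) by (simp add: subordinate_def)
  \<comment> \<open>clamping makes every point of the infinite grid a point of the path\<close>
  define p where "p i = glued_obj (?j (min 1 (real i / real (N + N))))" for i
  have clamp: "min 1 (real i / real (N + N)) = real i / real (N + N)" if "i \<le> N + N" for i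
    using grid_mem[OF that] by (intro min_absorb2) (simp only: atLeastAtMost_iff)
  have "chain_comp K (p 0) (\<lambda>i. local_arrow (piece ?j (N + N) i)) (N + N) =
      Comp K (chain_comp K (p N) (\<lambda>i. local_arrow (piece ?j (N + N) (N + i))) N)
        (chain_comp K (p 0) (\<lambda>i. local_arrow (piece ?j (N + N) i)) N)"
  proof (rule chain_comp_add[OF K_category])
    show "p i \<in> Obj K" for i
      unfolding p_def using lim_paths_mem[OF j] by (intro glued_obj_in_Obj) auto
    show "local_arrow (piece ?j (N + N) i) \<in> hom K (p i) (p (Suc i))" if "i < N + N" for i
      using local_arrow_piece_in_hom[OF j subordinate_conv_join[OF N e] that] that
      unfolding p_def by (simp only: clamp Suc_leI less_imp_le)
  qed
  moreover have "p 0 = glued_obj (\<gamma> 0)" "p N = glued_obj (\<rho> 0)"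
    using N0 e clamp[of N] by (simp_all add: p_def conv_join_def)
  ultimately show ?thesis
    using piece_conv_join[where N = N and \<gamma> = \<gamma> and \<rho> = \<rho>, OF N0 e]
    by (simp add: path_value_def cong: chain_comp_cong)
qed

section \<open>The universal property\<close>

definition arrow_value :: "'a pi_arrow \<Rightarrow> 'l" where
  "arrow_value a = (let \<gamma> = SOME \<gamma>. \<gamma> \<in> lim_paths X L \<and> path_arrow X L \<gamma> = a
    in path_value \<gamma> (SOME N. subordinate \<O> \<gamma> N))"

lemma arrow_value_path_arrow:
  assumes \<gamma>: "\<gamma> \<in> lim_paths X L" and N: "subordinate \<O> \<gamma> N"
  shows "arrow_value (path_arrow X L \<gamma>) = path_value \<gamma> N"
proof -
  define \<rho> where "\<rho> = (SOME \<rho>. \<rho> \<in> lim_paths X L \<and> path_arrow X L \<rho> = path_arrow X L \<gamma>)"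
  define M where "M = (SOME N. subordinate \<O> \<rho> N)"
  have \<rho>: "\<rho> \<in> lim_paths X L" "path_arrow X L \<rho> = path_arrow X L \<gamma>"
    using someI[of "\<lambda>\<rho>. \<rho> \<in> lim_paths X L \<and> path_arrow X L \<rho> = path_arrow X L \<gamma>" \<gamma>] \<gamma> by (auto simp: \<rho>_def)
  have "subordinate \<O> \<rho> M"
    unfolding M_def by (rule subordinate_exists[OF lim sys \<rho>(1)]) (rule someI)
  moreover have "rel_homotopic X L (\<rho> 0) (\<rho> 1) \<rho> \<gamma>"
    using path_arrow_eq_iff[OF lim \<rho>(1)] \<rho>(2) by blast
  ultimately have "path_value \<rho> M = path_value \<gamma> N"
    using path_value_homotopic N by blast
  then show ?thesis by (simp add: arrow_value_def Let_def \<rho>_def M_def)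
qed

text \<open>
  A path inside a member is its own subdivision into one piece.
\<close>

lemma arrow_value_small:
  assumes U: "U \<in> \<O>" "\<gamma> ` {0..1} \<subseteq> U" and \<gamma>: "\<gamma> \<in> lim_paths X L"
  shows "arrow_value (path_arrow X L \<gamma>) = on_arr (k U) (subspace_arrow L U \<gamma>)"
proof -
  have "subordinate \<O> \<gamma> 1" using U by (auto simp: subordinate_def)
  from arrow_value_path_arrow[OF \<gamma> this]
  have "arrow_value (path_arrow X L \<gamma>) = Comp K (local_arrow \<gamma>) (Id K (glued_obj (\<gamma> 0)))"
    by (simp add: path_value_def piece_def segment_0_1[OF \<gamma>])
  then show ?thesis
    using Comp_Id_right[OF K_category local_arrow_in_hom[OF U \<gamma>]] local_arrow_eq[OF U \<gamma>] by simp
qed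

definition glued_functor :: "('a, 'a pi_arrow, 'q, 'l) cat_map" where
  "glued_functor = \<lparr>on_obj = (\<lambda>x\<in>X. glued_obj x),
     on_arr = (\<lambda>a\<in>Arr (fundamental_groupoid X L). arrow_value a)\<rparr>"

lemma is_functor_glued_functor: "is_functor (fundamental_groupoid X L) K glued_functor"
proof -
  let ?G = "fundamental_groupoid X L"
  note Arr = Arr_fundamental_groupoid[OF lim]
  have value_in_hom: "arrow_value (path_arrow X L \<gamma>) \<in> hom K (glued_obj (\<gamma> 0)) (glued_obj (\<gamma> 1))"
    if \<gamma>: "\<gamma> \<in> lim_paths X L" for \<gamma>
  proof -
    obtain N where N: "subordinate \<O> \<gamma> N" using subordinate_exists[OF lim sys \<gamma>] .
    show ?thesis using path_value_in_hom[OF \<gamma> N] arrow_value_path_arrow[OF \<gamma> N] by simp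
  qed
  have value_Id: "arrow_value (Id ?G x) = Id K (glued_obj x)" if x: "x \<in> X" for x
  proof -
    obtain U where U: "U \<in> \<O>" "x \<in> U" using member_exists[OF x] .
    have "arrow_value (Id ?G x) = on_arr (k U) (Id (subspace_groupoid L U) x)"
      unfolding Id_fundamental_groupoid
      using U const_in_lim_paths[OF lim x] by (intro arrow_value_small) auto
    then show ?thesis
      using functor_k[OF U(1)] U by (simp add: is_functor_def glued_obj_eq[OF U])
  qed
  have value_Comp: "arrow_value (Comp ?G (path_arrow X L \<rho>) (path_arrow X L \<gamma>)) =
      Comp K (arrow_value (path_arrow X L \<rho>)) (arrow_value (path_arrow X L \<gamma>))"
    if p: "\<gamma> \<in> lim_paths X L" "\<rho> \<in> lim_paths X L" "\<gamma> 1 = \<rho> 0" for \<gamma> \<rho>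
  proof -
    \<comment> \<open>the two paths need a common number of pieces\<close>
    obtain M where M: "subordinate \<O> \<gamma> M" using subordinate_exists[OF lim sys p(1)] .
    obtain M' where M': "subordinate \<O> \<rho> M'" using subordinate_exists[OF lim sys p(2)] .
    have N: "subordinate \<O> \<gamma> (M * M')" "subordinate \<O> \<rho> (M * M')"
      using subordinate_refine[OF M, of M'] subordinate_refine[OF M', of M]
        M[unfolded subordinate_def] M'[unfolded subordinate_def]
      by (simp_all only: mult.commute)
    show ?thesis
      using path_value_conv_join[OF p N] arrow_value_path_arrow[OF p(1) N(1)] arrow_value_path_arrow[OF p(2) N(2)]
        arrow_value_path_arrow[OF conv_join_in_lim_paths[OF lim p] subordinate_conv_join[OF N p(3)]]
      by (simp add: Comp_path_arrow[OF lim p])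
  qed
  have Id_Arr: "Id ?G x \<in> Arr ?G" if "x \<in> X" for x
    using is_category_fundamental_groupoid[OF lim] that by (simp add: is_category_def)
  have Comp_Arr: "Comp ?G b a \<in> Arr ?G" if "a \<in> Arr ?G" "b \<in> Arr ?G" "Cod ?G a = Dom ?G b" for a b
    using is_category_fundamental_groupoid[OF lim] that by (simp add: is_category_def)
  have ends: "\<gamma> 0 \<in> X" "\<gamma> 1 \<in> X" if "\<gamma> \<in> lim_paths X L" for \<gamma>
    using lim_paths_mem[OF that] by auto
  have arr: "on_arr glued_functor a = arrow_value a" if "a \<in> Arr ?G" for a
    using that by (simp add: glued_functor_def)
  have obj: "on_obj glued_functor x = glued_obj x" if "x \<in> X" for x
    using that by (simp add: glued_functor_def)
  show ?thesis
    unfolding is_functor_def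
  proof (intro conjI ballI impI)
    show "on_obj glued_functor \<in> Obj ?G \<rightarrow>\<^sub>E Obj K"
      using glued_obj_in_Obj by (auto simp: glued_functor_def)
    show "on_arr glued_functor \<in> Arr ?G \<rightarrow>\<^sub>E Arr K"
      using value_in_hom unfolding glued_functor_def Arr by (auto simp: hom_def)
    show "Dom K (on_arr glued_functor a) = on_obj glued_functor (Dom ?G a)"
      "Cod K (on_arr glued_functor a) = on_obj glued_functor (Cod ?G a)" if "a \<in> Arr ?G" for a
      using that value_in_hom arr[OF that] obj ends by (auto simp: Arr hom_def)
    show "on_arr glued_functor (Id ?G x) = Id K (on_obj glued_functor x)" if "x \<in> Obj ?G" for x
      using that by (simp add: arr Id_Arr value_Id obj)
    show "on_arr glued_functor (Comp ?G b a) = Comp K (on_arr glued_functor b) (on_arr glued_functor a)"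
      if ab: "a \<in> Arr ?G" "b \<in> Arr ?G" "Cod ?G a = Dom ?G b" for a b
    proof -
      obtain \<gamma> \<rho> where "a = path_arrow X L \<gamma>" "\<gamma> \<in> lim_paths X L" "b = path_arrow X L \<rho>" "\<rho> \<in> lim_paths X L"
        using ab(1,2) by (auto simp: Arr)
      then show ?thesis
        using ab by (simp add: arr Comp_Arr value_Comp)
    qed
  qed
qed

lemma subspace_path_cases:
  assumes "U \<in> \<O>" "a \<in> Arr (subspace_groupoid L U)"
  obtains \<gamma> where "\<gamma> \<in> lim_paths X L" "\<gamma> ` {0..1} \<subseteq> U" "a = subspace_arrow L U \<gamma>"
  using assms that
  by (auto simp: Arr_fundamental_groupoid[OF limit_space_member] lim_paths_subspace_iff[OF subset_X])

lemma glued_functor_factors: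
  assumes U: "U \<in> \<O>"
  shows "comp_functor (subspace_groupoid L U) glued_functor
    (fundamental_functor U (subspace_conv L U) X L (\<lambda>x. x)) = k U" (is "?F = _")
proof (rule functor_eqI[OF functor_k[OF U], symmetric])
  show "on_obj ?F \<in> extensional (Obj (subspace_groupoid L U))"
    "on_arr ?F \<in> extensional (Arr (subspace_groupoid L U))"
    by (simp_all add: comp_functor_def)
  show "on_obj (k U) x = on_obj ?F x" if "x \<in> Obj (subspace_groupoid L U)" for x
    using that subset_X[OF U] glued_obj_eq[OF U, of x]
    by (auto simp: comp_functor_def compose_def fundamental_functor_def glued_functor_def)
  show "on_arr (k U) a = on_arr ?F a" if a: "a \<in> Arr (subspace_groupoid L U)" for a
  proof -
    obtain \<gamma> where \<gamma>: "\<gamma> \<in> lim_paths X L" "\<gamma> ` {0..1} \<subseteq> U" "a = subspace_arrow L U \<gamma>"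
      by (rule subspace_path_cases[OF U a])
    moreover have "path_arrow X L \<gamma> \<in> Arr (fundamental_groupoid X L)"
      using \<gamma>(1) by (simp add: Arr_fundamental_groupoid[OF lim])
    ultimately show ?thesis
      using a on_arr_inclusion_functor_total[OF lim subset_X[OF U] \<gamma>(1,2)] arrow_value_small[OF U \<gamma>(2,1)]
      by (simp add: comp_functor_def compose_def glued_functor_def)
  qed
qed

text \<open>
  A path is the composite of its pieces also in the fundamental groupoid, and on a piece the value of
  any functor compatible with the cocone is the prescribed one.
\<close>

lemma glued_functor_unique:
  assumes T: "is_functor (fundamental_groupoid X L) K T"
    and fac: "\<And>U. U \<in> \<O> \<Longrightarrow> comp_functor (subspace_groupoid L U) T
      (fundamental_functor U (subspace_conv L U) X L (\<lambda>x. x)) = k U"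
  shows "T = glued_functor"
proof -
  let ?G = "fundamental_groupoid X L"
  note Arr = Arr_fundamental_groupoid[OF lim]
  have obj: "on_obj T x = glued_obj x" if x: "x \<in> X" for x
  proof -
    obtain U where U: "U \<in> \<O>" "x \<in> U" using member_exists[OF x] .
    have "on_obj (k U) x = on_obj T x"
      unfolding fac[OF U(1), symmetric]
      using U by (simp add: comp_functor_def compose_def fundamental_functor_def)
    then show ?thesis using glued_obj_eq[OF U] by simp
  qed
  have small: "on_arr T (path_arrow X L \<delta>) = local_arrow \<delta>"
    if U: "U \<in> \<O>" "\<delta> ` {0..1} \<subseteq> U" and \<delta>: "\<delta> \<in> lim_paths X L" for U \<delta>
  proof -
    have "on_arr (k U) (subspace_arrow L U \<delta>) = on_arr T (path_arrow X L \<delta>)"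
      unfolding fac[OF U(1), symmetric]
      using subspace_arrow_in_Arr[OF U(1) \<delta> U(2)] on_arr_inclusion_functor_total[OF lim subset_X[OF U(1)] \<delta> U(2)]
      by (simp add: comp_functor_def compose_def)
    then show ?thesis using local_arrow_eq[OF U \<delta>] by simp
  qed
  have arr: "on_arr T (path_arrow X L \<gamma>) = arrow_value (path_arrow X L \<gamma>)" if \<gamma>: "\<gamma> \<in> lim_paths X L" for \<gamma>
  proof -
    \<comment> \<open>both functors are compared on the pieces of one subordinate subdivision\<close>
    obtain N where N: "subordinate \<O> \<gamma> N" using subordinate_exists[OF lim sys \<gamma>] .
    then have N0: "0 < N" by (simp add: subordinate_def)
    have c: "lim_continuous_on {0..1} X L \<gamma>" using \<gamma> by (simp add: lim_paths_def)
    have pieces: "piece \<gamma> N i \<in> lim_paths X L" if "i < N" for i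
      unfolding piece_def using grid_mem[of i N] grid_mem[of "Suc i" N] that
      by (intro segment_in_lim_paths[OF lim c]) auto
    have "on_arr T (chain_comp ?G (\<gamma> (real 0 / real N)) (\<lambda>i. path_arrow X L (piece \<gamma> N i)) N) =
        chain_comp K (on_obj T (\<gamma> (real 0 / real N))) (\<lambda>i. on_arr T (path_arrow X L (piece \<gamma> N i))) N"
    proof (rule functor_chain_comp[OF T is_category_fundamental_groupoid[OF lim]])
      show "\<gamma> (real 0 / real N) \<in> Obj ?G" using lim_paths_mem[OF \<gamma>] by simp
      show "path_arrow X L (piece \<gamma> N i) \<in> hom ?G (\<gamma> (real i / real N)) (\<gamma> (real (Suc i) / real N))"
        if "i < N" for i
        using pieces[OF that] by (simp add: hom_def Arr) (simp add: piece_def)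
    qed
    moreover have "on_arr T (path_arrow X L (piece \<gamma> N i)) = local_arrow (piece \<gamma> N i)" if "i < N" for i
      using N that pieces[OF that] small unfolding subordinate_iff by blast
    ultimately have "on_arr T (path_arrow X L \<gamma>) = path_value \<gamma> N"
      using path_arrow_chain_comp_pieces[OF lim \<gamma> N0] obj[of "\<gamma> 0"] lim_paths_mem[OF \<gamma>, of 0]
      by (simp add: path_value_def cong: chain_comp_cong)
    then show ?thesis by (simp only: arrow_value_path_arrow[OF \<gamma> N])
  qed
  show ?thesis
  proof (rule functor_eqI[OF T])
    show "on_obj glued_functor \<in> extensional (Obj ?G)" "on_arr glued_functor \<in> extensional (Arr ?G)"
      by (simp_all add: glued_functor_def)
    show "on_obj T x = on_obj glued_functor x" if "x \<in> Obj ?G" for x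
      using that obj by (simp add: glued_functor_def)
    show "on_arr T a = on_arr glued_functor a" if "a \<in> Arr ?G" for a
      using that arr by (auto simp: glued_functor_def Arr)
  qed
qed

end

theorem theorem4p0p1:
  fixes X :: "'a set" and L :: "'a filter \<Rightarrow> 'a set" and \<O> :: "'a set set"
  assumes "limit_space X L"
    and "convergence_system X L \<O>"
    and "\<And>U V. U \<in> \<O> \<Longrightarrow> V \<in> \<O> \<Longrightarrow> U \<inter> V \<in> \<O>"
  shows "is_groupoid_colimit TYPE(('q, 'l) cat)
    (inclusion_category \<O>)
    (\<lambda>U. fundamental_groupoid U (subspace_conv L U))
    (\<lambda>(U, V). fundamental_functor U (subspace_conv L U) V (subspace_conv L V) (\<lambda>x. x))
    (fundamental_groupoid X L)
    (\<lambda>U. fundamental_functor U (subspace_conv L U) X L (\<lambda>x. x))"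
  unfolding is_groupoid_colimit_def
proof (intro conjI allI impI)
  have sub: "U \<subseteq> X" if "U \<in> \<O>" for U
    using assms(2) that by (simp add: convergence_system_def)
  show "groupoid_diagram (inclusion_category \<O>) (subspace_groupoid L) (\<lambda>(U, V). inclusion_functor L U V)"
    by (rule groupoid_diagram_subspaces[OF assms(1) sub])
  show "groupoid_cocone (inclusion_category \<O>) (subspace_groupoid L) (\<lambda>(U, V). inclusion_functor L U V)
      (fundamental_groupoid X L) (\<lambda>U. fundamental_functor U (subspace_conv L U) X L (\<lambda>x. x))"
    by (rule groupoid_cocone_total_space[OF assms(1) sub])
  fix K :: "('q, 'l) cat" and k :: "'a set \<Rightarrow> ('a, 'a pi_arrow, 'q, 'l) cat_map"
  assume cocone: "groupoid_cocone (inclusion_category \<O>) (subspace_groupoid L)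
    (\<lambda>(U, V). inclusion_functor L U V) K k"
  interpret groupoid_cocone_on_system X L \<O> K k
    using assms cocone by (rule groupoid_cocone_on_system.intro)
  show "\<exists>!S. is_functor (fundamental_groupoid X L) K S \<and>
      (\<forall>U\<in>Obj (inclusion_category \<O>). comp_functor (subspace_groupoid L U) S
        (fundamental_functor U (subspace_conv L U) X L (\<lambda>x. x)) = k U)"
    unfolding inclusion_category_simps
    using is_functor_glued_functor glued_functor_factors glued_functor_unique by blast
qed

end
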